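(* Let $g\in L^\infty[-1/2,1/2]$ and let $\mathcal F(g)=\{e^{2\pi i n x}: n\in\mathbb N_0\}\cup\{g(x)e^{2\pi i n x}: n\in\mathbb N^-\}$. Then: (1) $\mathcal F(g)$ is complete in $L^2[-1/2,1/2]$ if and only if the Toeplitz operator $T_g$ is injective (i.e. $0\notin\sigma_p(T_g)$); (2) $\mathcal F(g)$ is a frame for $L^2[-1/2,1/2]$ if and only if $T_g$ is bounded and bounded below (i.e. $0\notin\sigma_{ap}(T_g)$); (3) $\mathcal F(g)$ is a Riesz basis for $L^2[-1/2,1/2]$ if and only if $T_g$ is bounded and invertible (i.e. $0\notin\sigma(T_g)$).
   Context: $\mathbb N_0=\{0,1,2,\dots\}$, $\mathbb N^-=\{-1,-2,\dots\}$. For $\phi\in L^1[-1/2,1/2]$, $\widehat\phi(n)=\int_{-1/2}^{1/2}\phi(x)e^{-2\pi i n x}\,dx$. Let $\tilde H^2=\{f\in L^2[-1/2,1/2]:\widehat f(n)=0 \text{ for all } n\in\mathbb N^-\}$ and $P_+$ the orthogonal projection of $L^2[-1/2,1/2]$ onto $\tilde H^2$. For $\phi\in L^\infty[-1/2,1/2]$ the Toeplitz operator $T_\phi:\tilde H^2\to\tilde H^2$ is $T_\phi f=P_+(\phi f)$; in the basis $\{e^{2\pi i n x}\}_{n\in\mathbb N_0}$ its matrix has $(j,k)$ entry $\widehat\phi(j-k)$ ($j,k\in\mathbb N_0$), so it may be viewed as an operator on $\ell^2(\mathbb N_0)$. A family $\{h_k\}$ in a Hilbert space $H$ is complete if $\langle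 f,h_k\rangle=0$ for all $k$ implies $f=0$; it is a frame if there are $0<A\le B<\infty$ with $A\|f\|^2\le\sum_k|\langle f,h_k\rangle|^2\le B\|f\|^2$ for all $f\in H$; it is a Riesz basis if it is a frame and every $f\in H$ has a unique expansion $f=\sum_k\alpha_k h_k$. An operator $T$ is bounded below if there is $c>0$ with $\|Tf\|\ge c\|f\|$ for all $f$. $\sigma_p$, $\sigma_{ap}$, $\sigma$ denote point spectrum, approximate point spectrum and spectrum. *)

theory Defs
  imports "HOL-Analysis.Analysis"
begin

definition IM :: "real measure" where
  "IM = lebesgue_on {-1/2..1/2}"

definition chr :: "int \<Rightarrow> real \<Rightarrow> complex" where
  "chr n x = exp (\<i> * complex_of_real (2 * pi * real_of_int n * x))"

text \<open>Membership in L^2[-1/2,1/2] and L^infinity[-1/2,1/2] (functions, identified a.e.).\<close>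
definition L2 :: "(real \<Rightarrow> complex) \<Rightarrow> bool" where
  "L2 f \<longleftrightarrow> f \<in> borel_measurable IM \<and> integrable IM (\<lambda>x. (cmod (f x))\<^sup>2)"

definition Linf :: "(real \<Rightarrow> complex) \<Rightarrow> bool" where
  "Linf g \<longleftrightarrow> g \<in> borel_measurable IM \<and> (\<exists>B. AE x in IM. cmod (g x) \<le> B)"

definition l2_inner :: "(real \<Rightarrow> complex) \<Rightarrow> (real \<Rightarrow> complex) \<Rightarrow> complex" where
  "l2_inner f h = (LINT x|IM. f x * cnj (h x))"

definition l2_normsq :: "(real \<Rightarrow> complex) \<Rightarrow> real" where
  "l2_normsq f = (LINT x|IM. (cmod (f x))\<^sup>2)"

definition fcoeff :: "(real \<Rightarrow> complex) \<Rightarrow> int \<Rightarrow> complex" where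
  "fcoeff \<phi> n = (LINT x|IM. \<phi> x * chr (- n) x)"

definition Fam :: "(real \<Rightarrow> complex) \<Rightarrow> int \<Rightarrow> real \<Rightarrow> complex" where
  "Fam g n = (if 0 \<le> n then chr n else (\<lambda>x. g x * chr n x))"

definition L2_complete :: "(int \<Rightarrow> real \<Rightarrow> complex) \<Rightarrow> bool" where
  "L2_complete h \<longleftrightarrow>
     (\<forall>f. L2 f \<longrightarrow> (\<forall>k. l2_inner f (h k) = 0) \<longrightarrow> (AE x in IM. f x = 0))"

definition L2_frame :: "(int \<Rightarrow> real \<Rightarrow> complex) \<Rightarrow> bool" where
  "L2_frame h \<longleftrightarrow> (\<exists>A B. 0 < A \<and> A \<le> B \<and>
     (\<forall>f. L2 f \<longrightarrow> (\<lambda>k. (cmod (l2_inner f (h k)))\<^sup>2) summable_on UNIV \<and>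
        A * l2_normsq f \<le> (\<Sum>\<^sub>\<infinity>k. (cmod (l2_inner f (h k)))\<^sup>2) \<and>
        (\<Sum>\<^sub>\<infinity>k. (cmod (l2_inner f (h k)))\<^sup>2) \<le> B * l2_normsq f))"

definition L2_expansion :: "(int \<Rightarrow> real \<Rightarrow> complex) \<Rightarrow> (int \<Rightarrow> complex) \<Rightarrow> (real \<Rightarrow> complex) \<Rightarrow> bool" where
  "L2_expansion h \<alpha> f \<longleftrightarrow>
     ((\<lambda>F. l2_normsq (\<lambda>x. f x - (\<Sum>k\<in>F. \<alpha> k * h k x))) \<longlongrightarrow> 0)
       (finite_subsets_at_top UNIV)"

definition L2_riesz_basis :: "(int \<Rightarrow> real \<Rightarrow> complex) \<Rightarrow> bool" where
  "L2_riesz_basis h \<longleftrightarrow> L2_frame h \<and> (\<forall>f. L2 f \<longrightarrow> (\<exists>!\<alpha>. L2_expansion h \<alpha> f))"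

definition ell2 :: "(nat \<Rightarrow> complex) \<Rightarrow> bool" where
  "ell2 c \<longleftrightarrow> (\<lambda>k. (cmod (c k))\<^sup>2) summable_on UNIV"

definition ell2_norm :: "(nat \<Rightarrow> complex) \<Rightarrow> real" where
  "ell2_norm c = sqrt (\<Sum>\<^sub>\<infinity>k. (cmod (c k))\<^sup>2)"

definition toeplitz :: "(real \<Rightarrow> complex) \<Rightarrow> (nat \<Rightarrow> complex) \<Rightarrow> nat \<Rightarrow> complex" where
  "toeplitz g c j = (\<Sum>\<^sub>\<infinity>k. fcoeff g (int j - int k) * c k)"

definition op_injective :: "((nat \<Rightarrow> complex) \<Rightarrow> nat \<Rightarrow> complex) \<Rightarrow> bool" where
  "op_injective T \<longleftrightarrow> (\<forall>c. ell2 c \<longrightarrow> T c = (\<lambda>_. 0) \<longrightarrow> c = (\<lambda>_. 0))"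

definition op_bounded :: "((nat \<Rightarrow> complex) \<Rightarrow> nat \<Rightarrow> complex) \<Rightarrow> bool" where
  "op_bounded T \<longleftrightarrow> (\<exists>B. \<forall>c. ell2 c \<longrightarrow> ell2 (T c) \<and> ell2_norm (T c) \<le> B * ell2_norm c)"

definition op_bounded_below :: "((nat \<Rightarrow> complex) \<Rightarrow> nat \<Rightarrow> complex) \<Rightarrow> bool" where
  "op_bounded_below T \<longleftrightarrow> (\<exists>C>0. \<forall>c. ell2 c \<longrightarrow> ell2_norm (T c) \<ge> C * ell2_norm c)"

definition op_invertible :: "((nat \<Rightarrow> complex) \<Rightarrow> nat \<Rightarrow> complex) \<Rightarrow> bool" where
  "op_invertible T \<longleftrightarrow> (\<exists>S. op_bounded S \<and>
     (\<forall>c. ell2 c \<longrightarrow> S (T c) = c \<and> T (S c) = c))"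

end

theory Submission
  imports Defs
begin

text \<open>A function \<open>f\<close> is orthogonal to all \<open>chr n\<close> with \<open>n \<ge> 0\<close> iff it has only negative frequencies.
  After the flip \<open>f \<mapsto> cnj (chr 1 * f)\<close> such an \<open>f\<close> is a Hardy function, and its inner products with the
  \<open>g * chr n\<close>, \<open>n < 0\<close>, become the conjugated coordinates of \<open>T\<^sub>g\<close> applied to it. So completeness
  is injectivity, and the lower frame bound is the lower bound of \<open>T\<^sub>g\<close>, since the nonnegative
  frequencies of \<open>f\<close> are controlled by the first half of the family.

  Expanding \<open>f\<close> in the family amounts to solving \<open>T\<^sub>g* d = b\<close>, where \<open>b\<close> collects the negative
  frequencies of \<open>f\<close>. If \<open>T\<^sub>g\<close> is bounded below then \<open>T\<^sub>g* T\<^sub>g\<close> is onto; so expansions exist,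
  and uniqueness of expansions, i.e. injectivity of \<open>T\<^sub>g*\<close>, forces \<open>T\<^sub>g\<close> to be onto. Conversely,
  if \<open>T\<^sub>g\<close> is onto there are functions biorthogonal to the family, so expansions are unique.\<close>

section \<open>Square-integrable functions on the interval\<close>

text \<open>\<open>toeplitz\<close> is a matrix acting through row sums, whereas the family and the
  flip live among functions. The two sides meet only through Parseval's identity, so completeness of
  the exponentials and Riesz-Fischer have to be available beforehand. The equation for the adjoint
  arises because expansions are built in the form \<open>f = r + g * w\<close>, with
  \<open>r\<close> carrying the nonnegative indices and \<open>w\<close> the negative ones:
  \<open>w\<close> is admissible exactly when \<open>f - g * w\<close> has no negative frequencies.
  After the flip, multiplication by \<open>g\<close> followed by restriction to negative frequencies
  is the Toeplitz operator with symbol \<open>cnj g\<close>, the adjoint of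
  \<open>toeplitz g\<close>. Surjectivity of that adjoint comes from the normal operator instead of
  closed ranges and orthogonal complements: a lower bound for \<open>toeplitz g\<close> makes the
  normal operator strictly positive, and a damped fixed point iteration solves the equation.\<close>

lemma space_IM: "space IM = {-1/2..1/2}"
  by (simp add: IM_def)

lemma finite_measure_IM: "finite_measure IM"
  unfolding IM_def by (rule finite_measure_lebesgue_on) auto

interpretation IM: finite_measure IM
  by (rule finite_measure_IM)

lemma measure_IM: "measure IM (space IM) = 1"
  by (simp add: IM_def measure_restrict_space)

lemma continuous_measurable_IM:
  fixes f :: "real \<Rightarrow> 'a::euclidean_space"
  assumes "continuous_on UNIV f"
  shows "f \<in> borel_measurable IM"
  unfolding IM_def
  using assms by (intro continuous_imp_measurable_on_sets_lebesgue) (auto intro: continuous_on_subset)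

lemma continuous_on_chr [continuous_intros]: "continuous_on S (chr n)"
  unfolding chr_def by (intro continuous_intros)

lemma chr_measurable [measurable]: "chr n \<in> borel_measurable IM"
  by (intro continuous_measurable_IM continuous_intros)

lemma norm_chr [simp]: "cmod (chr n x) = 1"
  by (simp add: chr_def)

lemma cnj_chr [simp]: "cnj (chr n x) = chr (-n) x"
  by (simp add: chr_def exp_cnj)

lemma chr_mult: "chr m x * chr n x = chr (m + n) x"
  by (simp add: chr_def exp_add [symmetric] algebra_simps)

lemma chr_0 [simp]: "chr 0 x = 1"
  by (simp add: chr_def)

lemma integral_chr: "(LINT x|IM. chr n x) = (if n = 0 then 1 else 0)"
proof (cases "n = 0")
  case True
  then show ?thesis using measure_IM by (simp add: chr_def)
next
  case False
  define F where "F x = chr n x / (\<i> * complex_of_real (2 * pi * real_of_int n))" for x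
  have "((\<lambda>x. chr n x) has_integral (F (1/2) - F (-1/2))) {-1/2..1/2}"
  proof (rule fundamental_theorem_of_calculus)
    fix x :: real
    have "((\<lambda>z. exp (\<i> * complex_of_real (2 * pi * real_of_int n) * z) / (\<i> * complex_of_real (2 * pi * real_of_int n)))
        has_field_derivative chr n x) (at (complex_of_real x))"
      unfolding chr_def using False by (auto intro!: derivative_eq_intros simp: field_simps)
    then have "((\<lambda>x. exp (\<i> * complex_of_real (2 * pi * real_of_int n) * complex_of_real x) / (\<i> * complex_of_real (2 * pi * real_of_int n)))
        has_vector_derivative chr n x) (at x within {-1/2..1/2})"
      by (rule has_vector_derivative_real_field)
    then show "(F has_vector_derivative chr n x) (at x within {-1/2..1/2})"
      unfolding F_def chr_def by (simp add: mult.assoc)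
  qed auto
  moreover have "chr n (1/2) = chr n (-1/2)"
  proof -
    have "\<i> * complex_of_real (2 * pi * real_of_int n * (1/2)) =
        \<i> * complex_of_real (2 * pi * real_of_int n) + \<i> * complex_of_real (2 * pi * real_of_int n * (-1/2))"
      by (simp add: field_simps)
    then have "chr n (1/2) = exp (\<i> * complex_of_real (2 * pi * real_of_int n)) * chr n (-1/2)"
      unfolding chr_def exp_add [symmetric] by (rule arg_cong)
    also have "exp (\<i> * complex_of_real (2 * pi * real_of_int n)) = 1"
      using exp_2pi_1_int[of n] by (simp add: algebra_simps)
    finally show ?thesis by simp
  qed
  ultimately have hi: "(chr n has_integral 0) {-1/2..1/2}"
    by (simp add: F_def)
  have "integrable IM (chr n)"
    by (rule IM.integrable_const_bound[of _ 1]) auto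
  then have "(LINT x|IM. chr n x) = integral {-1/2..1/2} (chr n)"
    unfolding IM_def by (intro lebesgue_integral_eq_integral) auto
  with hi False show ?thesis by (simp add: integral_unique)
qed

lemma cnj_measurable: "f \<in> borel_measurable M \<Longrightarrow> (\<lambda>x. cnj (f x)) \<in> borel_measurable M"
  by (rule borel_measurable_continuous_on[of cnj]) (auto intro: continuous_intros)

lemma L2_measurable: "L2 f \<Longrightarrow> f \<in> borel_measurable IM"
  by (simp add: L2_def)

lemma L2_integrable_mult:
  assumes f: "L2 f" and h: "L2 h"
  shows "integrable IM (\<lambda>x. f x * h x)"
proof -
  have [measurable]: "f \<in> borel_measurable IM" "h \<in> borel_measurable IM"
    using f h by (auto simp: L2_def)
  have "integrable IM (\<lambda>x. (cmod (f x))\<^sup>2 + (cmod (h x))\<^sup>2)"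
    using f h by (auto simp: L2_def)
  then show ?thesis
  proof (rule Bochner_Integration.integrable_bound)
    show "AE x in IM. norm (f x * h x) \<le> norm ((cmod (f x))\<^sup>2 + (cmod (h x))\<^sup>2)"
    proof (rule AE_I2)
      fix x
      have "2 * (cmod (f x) * cmod (h x)) \<le> (cmod (f x))\<^sup>2 + (cmod (h x))\<^sup>2"
        using sum_squares_bound[of "cmod (f x)" "cmod (h x)"] by simp
      moreover have "0 \<le> cmod (f x) * cmod (h x)" by simp
      ultimately have "cmod (f x) * cmod (h x) \<le> (cmod (f x))\<^sup>2 + (cmod (h x))\<^sup>2" by linarith
      then show "norm (f x * h x) \<le> norm ((cmod (f x))\<^sup>2 + (cmod (h x))\<^sup>2)"
        by (simp add: norm_mult)
    qed
  qed measurable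
qed

lemma L2_Linf_mult:
  assumes "L2 f" and "Linf g"
  shows "L2 (\<lambda>x. g x * f x)"
proof -
  obtain B where B: "AE x in IM. cmod (g x) \<le> B" using assms by (auto simp: Linf_def)
  have [measurable]: "f \<in> borel_measurable IM" "g \<in> borel_measurable IM"
    using assms by (auto simp: L2_def Linf_def)
  have "integrable IM (\<lambda>x. B\<^sup>2 * (cmod (f x))\<^sup>2)"
    using assms by (auto simp: L2_def)
  then have "integrable IM (\<lambda>x. (cmod (g x * f x))\<^sup>2)"
  proof (rule Bochner_Integration.integrable_bound)
    show "AE x in IM. norm ((cmod (g x * f x))\<^sup>2) \<le> norm (B\<^sup>2 * (cmod (f x))\<^sup>2)"
      using B
    proof eventually_elim
      case (elim x)
      then have "(cmod (g x))\<^sup>2 \<le> B\<^sup>2" by (intro power_mono) auto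
      then show ?case by (simp add: norm_mult power_mult_distrib mult_right_mono)
    qed
  qed measurable
  then show ?thesis by (simp add: L2_def)
qed

lemma Linf_chr [simp]: "Linf (chr n)"
  unfolding Linf_def by (auto intro!: exI[of _ 1])

lemma Linf_const [simp]: "Linf (\<lambda>x. c)"
  unfolding Linf_def by auto

lemma Linf_cnj: "Linf g \<Longrightarrow> Linf (\<lambda>x. cnj (g x))"
  unfolding Linf_def by (auto intro: cnj_measurable)

lemma L2_const [simp]: "L2 (\<lambda>x. c)"
  unfolding L2_def by auto

lemma L2_chr [simp]: "L2 (chr n)"
  unfolding L2_def by auto

lemma L2_cmult: "L2 f \<Longrightarrow> L2 (\<lambda>x. c * f x)"
  using L2_Linf_mult[of f "\<lambda>x. c"] by simp

lemma L2_add: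
  assumes "L2 f" "L2 h"
  shows "L2 (\<lambda>x. f x + h x)"
proof -
  have [measurable]: "f \<in> borel_measurable IM" "h \<in> borel_measurable IM"
    using assms by (auto simp: L2_def)
  have "integrable IM (\<lambda>x. 2 * (cmod (f x))\<^sup>2 + 2 * (cmod (h x))\<^sup>2)"
    using assms by (auto simp: L2_def)
  then have "integrable IM (\<lambda>x. (cmod (f x + h x))\<^sup>2)"
  proof (rule Bochner_Integration.integrable_bound)
    show "AE x in IM. norm ((cmod (f x + h x))\<^sup>2) \<le> norm (2 * (cmod (f x))\<^sup>2 + 2 * (cmod (h x))\<^sup>2)"
    proof (rule AE_I2)
      fix x
      have "(cmod (f x + h x))\<^sup>2 \<le> (cmod (f x) + cmod (h x))\<^sup>2"
        by (intro power_mono norm_triangle_ineq) auto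
      also have "\<dots> \<le> 2 * (cmod (f x))\<^sup>2 + 2 * (cmod (h x))\<^sup>2"
        using sum_squares_bound[of "cmod (f x)" "cmod (h x)"] by (simp add: power2_sum)
      finally show "norm ((cmod (f x + h x))\<^sup>2) \<le> norm (2 * (cmod (f x))\<^sup>2 + 2 * (cmod (h x))\<^sup>2)"
        by simp
    qed
  qed measurable
  then show ?thesis by (simp add: L2_def)
qed

lemma L2_diff: "L2 f \<Longrightarrow> L2 h \<Longrightarrow> L2 (\<lambda>x. f x - h x)"
  using L2_add[OF _ L2_cmult[of h "-1"], of f] by simp

lemma L2_cnj: "L2 f \<Longrightarrow> L2 (\<lambda>x. cnj (f x))"
  unfolding L2_def by (auto intro: cnj_measurable)

lemma L2_sum: "(\<And>k. k \<in> F \<Longrightarrow> L2 (f k)) \<Longrightarrow> L2 (\<lambda>x. \<Sum>k\<in>F. f k x)"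
  by (induction F rule: infinite_finite_induct) (auto intro!: L2_add)

lemma l2_inner_integrable: "L2 f \<Longrightarrow> L2 h \<Longrightarrow> integrable IM (\<lambda>x. f x * cnj (h x))"
  by (intro L2_integrable_mult L2_cnj)

lemma l2_inner_diff:
  "L2 f \<Longrightarrow> L2 f' \<Longrightarrow> L2 h \<Longrightarrow> l2_inner (\<lambda>x. f x - f' x) h = l2_inner f h - l2_inner f' h"
  unfolding l2_inner_def by (simp add: algebra_simps l2_inner_integrable)

lemma l2_inner_cmult: "l2_inner (\<lambda>x. c * f x) h = c * l2_inner f h"
  unfolding l2_inner_def by (simp add: mult.assoc)

lemma l2_inner_sum:
  assumes "\<And>k. k \<in> F \<Longrightarrow> L2 (f k)" "L2 h"
  shows "l2_inner (\<lambda>x. \<Sum>k\<in>F. f k x) h = (\<Sum>k\<in>F. l2_inner (f k) h)"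
  unfolding l2_inner_def sum_distrib_right
  using assms by (intro Bochner_Integration.integral_sum l2_inner_integrable)

lemma l2_inner_commute: "l2_inner f h = cnj (l2_inner h f)"
proof -
  have "cnj (l2_inner h f) = (LINT x|IM. cnj (h x * cnj (f x)))"
    unfolding l2_inner_def by (rule Bochner_Integration.integral_cnj[symmetric])
  then show ?thesis by (simp add: l2_inner_def mult.commute)
qed

lemma l2_inner_self: "l2_inner f f = complex_of_real (l2_normsq f)"
  unfolding l2_inner_def l2_normsq_def
  by (simp add: complex_norm_square [symmetric] flip: integral_complex_of_real)

lemma l2_inner_cong:
  "AE x in IM. f x = f' x \<Longrightarrow> L2 f \<Longrightarrow> L2 f' \<Longrightarrow> L2 h \<Longrightarrow> l2_inner f h = l2_inner f' h"
  unfolding l2_inner_def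
  by (rule integral_cong_AE) (auto intro: borel_measurable_integrable l2_inner_integrable)

lemma l2_normsq_cong:
  assumes "AE x in IM. f x = f' x" "L2 f" "L2 f'"
  shows "l2_normsq f = l2_normsq f'"
  unfolding l2_normsq_def
  using assms by (intro integral_cong_AE) (auto simp: L2_def intro: borel_measurable_integrable)

lemma l2_normsq_nonneg [simp]: "0 \<le> l2_normsq f"
  unfolding l2_normsq_def by (rule Bochner_Integration.integral_nonneg) simp

lemma l2_normsq_cnj [simp]: "l2_normsq (\<lambda>x. cnj (f x)) = l2_normsq f"
  by (simp add: l2_normsq_def)

lemma l2_normsq_add_le:
  assumes "L2 f" "L2 h"
  shows "l2_normsq (\<lambda>x. f x + h x) \<le> 2 * l2_normsq f + 2 * l2_normsq h"
proof -
  have "l2_normsq (\<lambda>x. f x + h x) \<le> (LINT x|IM. 2 * (cmod (f x))\<^sup>2 + 2 * (cmod (h x))\<^sup>2)"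
    unfolding l2_normsq_def
  proof (rule integral_mono)
    fix x
    have "(cmod (f x + h x))\<^sup>2 \<le> (cmod (f x) + cmod (h x))\<^sup>2"
      by (intro power_mono norm_triangle_ineq) auto
    also have "\<dots> \<le> 2 * (cmod (f x))\<^sup>2 + 2 * (cmod (h x))\<^sup>2"
      using sum_squares_bound[of "cmod (f x)" "cmod (h x)"] by (simp add: power2_sum)
    finally show "(cmod (f x + h x))\<^sup>2 \<le> 2 * (cmod (f x))\<^sup>2 + 2 * (cmod (h x))\<^sup>2" .
  qed (use assms L2_add[OF assms] in \<open>auto simp: L2_def\<close>)
  also have "\<dots> = 2 * l2_normsq f + 2 * l2_normsq h"
    unfolding l2_normsq_def using assms by (subst Bochner_Integration.integral_add) (auto simp: L2_def)
  finally show ?thesis .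
qed

lemma l2_normsq_mult_le:
  assumes "L2 f" "g \<in> borel_measurable IM" "AE x in IM. cmod (g x) \<le> B"
  shows "l2_normsq (\<lambda>x. g x * f x) \<le> B\<^sup>2 * l2_normsq f"
proof -
  have "Linf g" using assms by (auto simp: Linf_def)
  have "l2_normsq (\<lambda>x. g x * f x) \<le> (LINT x|IM. B\<^sup>2 * (cmod (f x))\<^sup>2)"
    unfolding l2_normsq_def
  proof (rule integral_mono_AE)
    show "AE x in IM. (cmod (g x * f x))\<^sup>2 \<le> B\<^sup>2 * (cmod (f x))\<^sup>2"
      using assms(3)
    proof eventually_elim
      case (elim x)
      then have "(cmod (g x))\<^sup>2 \<le> B\<^sup>2" by (intro power_mono) auto
      then show ?case by (simp add: norm_mult power_mult_distrib mult_right_mono)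
    qed
  qed (use assms L2_Linf_mult[OF assms(1) \<open>Linf g\<close>] in \<open>auto simp: L2_def\<close>)
  then show ?thesis by (simp add: l2_normsq_def)
qed

text \<open>Integrate the weighted inequality between \<open>2 * cmod (f x * h x)\<close> and
  \<open>t * (cmod (f x))\<^sup>2 + (cmod (h x))\<^sup>2 / t\<close>, then optimise
  \<open>t\<close>. The modulus stays inside the integral, so that pairing with a constant also
  bounds L1 norms.\<close>

lemma L2_Cauchy_Schwarz_abs:
  assumes f: "L2 f" and h: "L2 h"
  shows "(LINT x|IM. cmod (f x * h x)) \<le> sqrt (l2_normsq f) * sqrt (l2_normsq h)"
proof -
  let ?I = "LINT x|IM. cmod (f x * h x)"
  have int: "integrable IM (\<lambda>x. cmod (f x * h x))"
    using L2_integrable_mult[OF f h] by simp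
  have key: "2 * ?I \<le> t * l2_normsq f + l2_normsq h / t" if "t > 0" for t
  proof -
    have "(LINT x|IM. 2 * cmod (f x * h x)) \<le> (LINT x|IM. t * (cmod (f x))\<^sup>2 + (cmod (h x))\<^sup>2 / t)"
    proof (rule integral_mono)
      fix x
      have "0 \<le> (t * cmod (f x) - cmod (h x))\<^sup>2 / t" using that by simp
      also have "\<dots> = t * (cmod (f x))\<^sup>2 + (cmod (h x))\<^sup>2 / t - 2 * cmod (f x * h x)"
        using that by (simp add: power2_eq_square norm_mult field_simps)
      finally show "2 * cmod (f x * h x) \<le> t * (cmod (f x))\<^sup>2 + (cmod (h x))\<^sup>2 / t" by simp
    qed (use int f h in \<open>auto simp: L2_def\<close>)
    also have "\<dots> = t * l2_normsq f + l2_normsq h / t"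
      unfolding l2_normsq_def using f h by (subst Bochner_Integration.integral_add) (auto simp: L2_def)
    finally show ?thesis by simp
  qed
  \<comment> \<open>The optimal \<open>t\<close> is a quotient of the two norms and degenerates if
    one of them vanishes. Adding \<open>e\<close> to both squared norms avoids this;
    \<open>e\<close> tends to 0 at the end.\<close>
  have key': "2 * ?I \<le> t * (l2_normsq f + e) + (l2_normsq h + e) / t" if "t > 0" "e > 0" for t e
  proof -
    have "t * l2_normsq f + l2_normsq h / t \<le> t * (l2_normsq f + e) + (l2_normsq h + e) / t"
      using that by (intro add_mono mult_left_mono divide_right_mono) auto
    with key[OF that(1)] show ?thesis by simp
  qed
  have bd: "?I \<le> sqrt (l2_normsq f + e) * sqrt (l2_normsq h + e)" if "e > 0" for e
  proof -
    define p q where "p = sqrt (l2_normsq f + e)" and "q = sqrt (l2_normsq h + e)"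
    have pq: "p > 0" "q > 0" "p\<^sup>2 = l2_normsq f + e" "q\<^sup>2 = l2_normsq h + e"
      using that l2_normsq_nonneg[of f] l2_normsq_nonneg[of h]
      by (auto simp: p_def q_def add_nonneg_pos simp del: l2_normsq_nonneg)
    have "2 * ?I \<le> (q / p) * p\<^sup>2 + q\<^sup>2 / (q / p)"
      using key'[of "q / p" e] pq that by simp
    also have "\<dots> = 2 * (p * q)"
      using pq(1,2) by (simp add: field_simps power2_eq_square)
    finally show ?thesis by (simp add: p_def q_def)
  qed
  have "((\<lambda>e. sqrt (l2_normsq f + e) * sqrt (l2_normsq h + e)) \<longlongrightarrow>
      sqrt (l2_normsq f + 0) * sqrt (l2_normsq h + 0)) (at_right 0)"
    by (intro tendsto_intros)
  then have "?I \<le> sqrt (l2_normsq f + 0) * sqrt (l2_normsq h + 0)"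
    by (rule tendsto_lowerbound) (auto intro!: eventually_at_rightI[of 0 1] bd)
  then show ?thesis by simp
qed

lemma L2_Cauchy_Schwarz:
  assumes f: "L2 f" and h: "L2 h"
  shows "cmod (l2_inner f h) \<le> sqrt (l2_normsq f) * sqrt (l2_normsq h)"
proof -
  have "cmod (l2_inner f h) \<le> (LINT x|IM. cmod (f x * cnj (h x)))"
    unfolding l2_inner_def by (rule integral_norm_bound)
  also have "\<dots> \<le> sqrt (l2_normsq f) * sqrt (l2_normsq h)"
    using L2_Cauchy_Schwarz_abs[OF f L2_cnj[OF h]] by simp
  finally show ?thesis .
qed

text \<open>Continuity of the inner product by Cauchy-Schwarz. The filter is arbitrary because the
  limit is taken both along symmetric partial sums and along the net of finite index sets.\<close>

lemma l2_inner_tendsto: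
  assumes "\<And>i. L2 (f i)" "L2 u" "L2 h" "((\<lambda>i. l2_normsq (\<lambda>x. u x - f i x)) \<longlongrightarrow> 0) F"
  shows "((\<lambda>i. l2_inner (f i) h) \<longlongrightarrow> l2_inner u h) F"
proof -
  have "((\<lambda>i. sqrt (l2_normsq (\<lambda>x. u x - f i x)) * sqrt (l2_normsq h)) \<longlongrightarrow> sqrt 0 * sqrt (l2_normsq h)) F"
    by (intro tendsto_intros assms)
  moreover have "cmod (l2_inner u h - l2_inner (f i) h) \<le> sqrt (l2_normsq (\<lambda>x. u x - f i x)) * sqrt (l2_normsq h)" for i
    using L2_Cauchy_Schwarz[OF L2_diff[OF assms(2) assms(1)[of i]] assms(3)] assms by (simp only: l2_inner_diff)
  ultimately have "((\<lambda>i. l2_inner u h - l2_inner (f i) h) \<longlongrightarrow> 0) F"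
    by - (rule Lim_null_comparison[where g = "\<lambda>i. sqrt (l2_normsq (\<lambda>x. u x - f i x)) * sqrt (l2_normsq h)"],
      simp_all add: always_eventually)
  then have "((\<lambda>i. l2_inner u h - (l2_inner u h - l2_inner (f i) h)) \<longlongrightarrow> l2_inner u h - 0) F"
    by (intro tendsto_intros)
  then show ?thesis by simp
qed

section \<open>Fourier coefficients and Bessel's identity\<close>

lemma fcoeff_inner: "fcoeff f n = l2_inner f (chr n)"
  by (simp add: fcoeff_def l2_inner_def)

lemma l2_inner_chr: "l2_inner (chr m) (chr n) = (if m = n then 1 else 0)"
  by (simp add: l2_inner_def chr_mult integral_chr)

lemma fcoeff_chr: "fcoeff (chr m) n = (if m = n then 1 else 0)"
  by (simp add: fcoeff_inner l2_inner_chr)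

lemma fcoeff_cong:
  "AE x in IM. f x = f' x \<Longrightarrow> L2 f \<Longrightarrow> L2 f' \<Longrightarrow> fcoeff f n = fcoeff f' n"
  unfolding fcoeff_inner by (rule l2_inner_cong) auto

lemma fcoeff_diff: "L2 f \<Longrightarrow> L2 h \<Longrightarrow> fcoeff (\<lambda>x. f x - h x) n = fcoeff f n - fcoeff h n"
  by (simp add: fcoeff_inner l2_inner_diff)

lemma fcoeff_cnj: "fcoeff (\<lambda>x. cnj (f x)) n = cnj (fcoeff f (-n))"
proof -
  have "cnj (fcoeff f (-n)) = (LINT x|IM. cnj (f x * chr n x))"
    unfolding fcoeff_def by (simp flip: Bochner_Integration.integral_cnj)
  then show ?thesis by (simp add: fcoeff_def)
qed

lemma fcoeff_chr_mult: "fcoeff (\<lambda>x. chr m x * f x) n = fcoeff f (n - m)"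
proof -
  have "chr m x * f x * chr (- n) x = f x * chr (-(n - m)) x" for x
    using chr_mult[of m x "-n"] by (simp add: algebra_simps)
  then show ?thesis unfolding fcoeff_def by presburger
qed

abbreviation trig_sum :: "(int \<Rightarrow> complex) \<Rightarrow> int set \<Rightarrow> real \<Rightarrow> complex" where
  "trig_sum a F x \<equiv> \<Sum>k\<in>F. a k * chr k x"

lemma L2_trig_sum [simp]: "L2 (trig_sum a F)"
  by (intro L2_sum L2_cmult L2_chr)

lemma l2_inner_trig_sum: "L2 h \<Longrightarrow> l2_inner (trig_sum a F) h = (\<Sum>k\<in>F. a k * cnj (fcoeff h k))"
  by (subst l2_inner_sum) (auto simp: l2_inner_cmult fcoeff_inner L2_cmult intro!: sum.cong l2_inner_commute)

lemma fcoeff_trig_sum: "finite F \<Longrightarrow> fcoeff (trig_sum a F) n = (if n \<in> F then a n else 0)"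
  by (simp add: fcoeff_inner[of "trig_sum a F"] l2_inner_trig_sum fcoeff_chr if_distrib cong: if_cong)

lemma l2_normsq_diff:
  assumes "L2 f" "L2 h"
  shows "l2_normsq (\<lambda>x. f x - h x) = l2_normsq f - 2 * Re (l2_inner f h) + l2_normsq h"
proof -
  note [simp] = l2_inner_diff assms L2_diff
  have "l2_inner (\<lambda>x. f x - h x) (\<lambda>x. f x - h x) =
      l2_inner f (\<lambda>x. f x - h x) - l2_inner h (\<lambda>x. f x - h x)" by simp
  also have "\<dots> = cnj (l2_inner (\<lambda>x. f x - h x) f) - cnj (l2_inner (\<lambda>x. f x - h x) h)"
    using l2_inner_commute[of f "\<lambda>x. f x - h x"] l2_inner_commute[of h "\<lambda>x. f x - h x"] by (simp only:)
  also have "\<dots> = l2_inner f f - cnj (l2_inner h f) - cnj (l2_inner f h) + l2_inner h h"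
    by (simp add: l2_inner_self)
  also have "cnj (l2_inner h f) = l2_inner f h" by (rule l2_inner_commute[symmetric])
  finally show ?thesis
    by (simp add: l2_inner_self complex_eq_iff)
qed

lemma l2_normsq_trig_sum: "finite F \<Longrightarrow> l2_normsq (trig_sum a F) = (\<Sum>k\<in>F. (cmod (a k))\<^sup>2)"
proof -
  assume F: "finite F"
  have "complex_of_real (l2_normsq (trig_sum a F)) = (\<Sum>k\<in>F. a k * cnj (a k))"
    unfolding l2_inner_self[symmetric] using F by (simp add: l2_inner_trig_sum fcoeff_trig_sum)
  also have "\<dots> = complex_of_real (\<Sum>k\<in>F. (cmod (a k))\<^sup>2)"
    by (simp add: complex_norm_square del: of_real_power)
  finally show ?thesis using of_real_eq_iff by blast
qed

text \<open>Pythagoras for the projection onto the characters in \<open>F\<close>. The exact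
  equality later turns convergence of the square sums into convergence of the Fourier series and
  back.\<close>

lemma Bessel_identity:
  assumes "L2 f" "finite F"
  shows "l2_normsq (\<lambda>x. f x - trig_sum (fcoeff f) F x) = l2_normsq f - (\<Sum>k\<in>F. (cmod (fcoeff f k))\<^sup>2)"
proof -
  have "cnj (l2_inner (trig_sum (fcoeff f) F) f) = complex_of_real (\<Sum>k\<in>F. (cmod (fcoeff f k))\<^sup>2)"
    using assms by (simp add: l2_inner_trig_sum complex_norm_square mult.commute[of "cnj _"] del: of_real_power)
  then have "l2_inner f (trig_sum (fcoeff f) F) = complex_of_real (\<Sum>k\<in>F. (cmod (fcoeff f k))\<^sup>2)"
    by (subst l2_inner_commute)
  then show ?thesis using assms by (simp add: l2_normsq_diff l2_normsq_trig_sum)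
qed

lemma Bessel_inequality: "L2 f \<Longrightarrow> finite F \<Longrightarrow> (\<Sum>k\<in>F. (cmod (fcoeff f k))\<^sup>2) \<le> l2_normsq f"
  using Bessel_identity[of f F] l2_normsq_nonneg[of "\<lambda>x. f x - trig_sum (fcoeff f) F x"] by linarith

lemma fcoeff_square_summable: "L2 f \<Longrightarrow> (\<lambda>k. (cmod (fcoeff f k))\<^sup>2) summable_on A"
  by (rule nonneg_bdd_above_summable_on) (auto intro!: bdd_aboveI2 Bessel_inequality)

section \<open>Completeness of the trigonometric system\<close>

text \<open>An inductive closure instead of explicit finite sums: stability under products and
  orthogonality then follow by induction, without tracking frequencies.\<close>

inductive trig_poly :: "(real \<Rightarrow> complex) \<Rightarrow> bool" where
  trig_chr: "trig_poly (chr n)"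
| trig_cmult: "trig_poly p \<Longrightarrow> trig_poly (\<lambda>x. c * p x)"
| trig_add: "trig_poly p \<Longrightarrow> trig_poly q \<Longrightarrow> trig_poly (\<lambda>x. p x + q x)"

lemma trig_const: "trig_poly (\<lambda>x. c)"
  using trig_cmult[OF trig_chr[of 0], of c] by simp

lemma trig_chr_mult: "trig_poly q \<Longrightarrow> trig_poly (\<lambda>x. chr n x * q x)"
proof (induction rule: trig_poly.induct)
  case (trig_chr m)
  have "(\<lambda>x. chr n x * chr m x) = chr (n + m)" by (simp add: chr_mult)
  then show ?case using trig_poly.trig_chr by metis
next
  case (trig_cmult p c)
  then show ?case using trig_poly.trig_cmult[of _ c] by (simp add: mult.left_commute)
next
  case (trig_add p q)
  then show ?case using trig_poly.trig_add by (simp add: distrib_left)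
qed

lemma trig_mult: "trig_poly p \<Longrightarrow> trig_poly q \<Longrightarrow> trig_poly (\<lambda>x. p x * q x)"
proof (induction rule: trig_poly.induct)
  case (trig_chr m)
  then show ?case by (rule trig_chr_mult)
next
  case (trig_cmult p c)
  then show ?case using trig_poly.trig_cmult[of _ c] by (simp add: mult.assoc)
next
  case (trig_add p q)
  then show ?case using trig_poly.trig_add by (simp add: distrib_right)
qed

text \<open>On the unit circle the conjugate of \<open>chr 1 x\<close> is \<open>chr (-1) x\<close>,
  so a real-linear functional of \<open>chr 1 x\<close> is already a trigonometric polynomial;
  closure under sums and products does the rest.\<close>

lemma trig_real_polynomial:
  "real_polynomial_function p \<Longrightarrow> trig_poly (\<lambda>x. complex_of_real (p (chr 1 x)))"
proof (induction rule: real_polynomial_function.induct)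
  case (linear f)
  then interpret bounded_linear f .
  \<comment> \<open>\<open>f\<close> is only real-linear, hence determined by \<open>f 1\<close> and
    \<open>f \<i>\<close>; real and imaginary parts are written through \<open>z\<close> and its
    conjugate.\<close>
  have rep: "complex_of_real (f z) = (f 1 / 2) * (z + cnj z) + (- \<i> * f \<i> / 2) * (z + (-1) * cnj z)" for z
  proof -
    have "f z = f (Re z *\<^sub>R 1 + Im z *\<^sub>R \<i>)"
      by (rule arg_cong[where f = f]) (simp add: complex_eq_iff)
    then have "f z = Re z * f 1 + Im z * f \<i>"
      by (simp only: add scaleR) simp
    moreover have "z + (-1) * cnj z = of_real (2 * Im z) * \<i>"
      using complex_diff_cnj[of z] by simp
    ultimately show ?thesis
      by (simp add: complex_add_cnj complex_eq_iff)
  qed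
  have "trig_poly (\<lambda>x. (f 1 / 2) * (chr 1 x + chr (-1) x) + (- \<i> * f \<i> / 2) * (chr 1 x + (-1) * chr (-1) x))"
    by (intro trig_add trig_cmult trig_chr)
  then show ?case unfolding rep[of "chr 1 _"] cnj_chr .
next
  case (const c)
  show ?case by (rule trig_const)
next
  case (add f g)
  then show ?case by (simp add: trig_add)
next
  case (mult f g)
  then show ?case by (simp add: trig_mult)
qed

lemma trig_polynomial_function:
  fixes p :: "complex \<Rightarrow> complex"
  assumes "polynomial_function p"
  shows "trig_poly (\<lambda>x. p (chr 1 x))"
proof -
  have "real_polynomial_function (Re \<circ> p)" "real_polynomial_function (Im \<circ> p)"
    using assms bounded_linear_Re bounded_linear_Im unfolding polynomial_function_def by blast+
  from this[THEN trig_real_polynomial]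
  have "trig_poly (\<lambda>x. complex_of_real (Re (p (chr 1 x))) + \<i> * complex_of_real (Im (p (chr 1 x))))"
    by (intro trig_add trig_cmult) (simp_all add: o_def)
  then show ?thesis by (simp add: complex_eq[symmetric])
qed

lemma L2_trig_poly: "trig_poly p \<Longrightarrow> L2 p"
  by (induction rule: trig_poly.induct) (auto intro: L2_cmult L2_add)

lemma trig_poly_orthogonal:
  assumes "trig_poly p" and f: "L2 f" and 0: "\<And>n. fcoeff f n = 0"
  shows "(LINT x|IM. f x * p x) = 0"
  using assms(1)
proof (induction rule: trig_poly.induct)
  case (trig_chr n)
  then show ?case using 0[of "-n"] by (simp add: fcoeff_def)
next
  case (trig_cmult p c)
  then show ?case by (simp add: mult.left_commute[of _ c])
next
  case (trig_add p q)
  then show ?case using f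
    by (simp add: distrib_left L2_integrable_mult L2_trig_poly)
qed

text \<open>Replacing \<open>G\<close> by a polynomial within \<open>e\<close> changes the integral
  by at most \<open>e\<close> times the L1 norm of \<open>f\<close>, which is finite on a space of
  finite measure, and the polynomial contributes 0.\<close>

lemma continuous_circle_orthogonal:
  fixes G :: "complex \<Rightarrow> complex"
  assumes G: "continuous_on (sphere 0 1) G" and f: "L2 f" and 0: "\<And>n. fcoeff f n = 0"
    and [measurable]: "(\<lambda>x. G (chr 1 x)) \<in> borel_measurable IM"
  shows "(LINT x|IM. f x * G (chr 1 x)) = 0"
proof -
  have f1: "integrable IM f" using L2_integrable_mult[OF f L2_const[of 1]] by simp
  note [measurable] = L2_measurable[OF f]
  obtain B where B: "\<And>z. z \<in> sphere 0 1 \<Longrightarrow> cmod (G z) \<le> B"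
    using compact_imp_bounded[OF compact_continuous_image[OF G compact_sphere]]
    unfolding bounded_iff by (metis imageI)
  have int: "integrable IM (\<lambda>x. f x * G (chr 1 x))"
  proof (rule Bochner_Integration.integrable_bound)
    show "integrable IM (\<lambda>x. B * cmod (f x))" using f1 by simp
    show "AE x in IM. cmod (f x * G (chr 1 x)) \<le> norm (B * cmod (f x))"
    proof (rule AE_I2)
      fix x
      have "cmod (G (chr 1 x)) \<le> \<bar>B\<bar>" using B[of "chr 1 x"] by simp
      then show "cmod (f x * G (chr 1 x)) \<le> norm (B * cmod (f x))"
        by (simp add: norm_mult abs_mult mult.commute[of "cmod (f x)"] mult_right_mono)
    qed
  qed measurable
  have bound: "cmod (LINT x|IM. f x * G (chr 1 x)) \<le> e * (LINT x|IM. cmod (f x))" if e: "e > 0" for e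
  proof -
    obtain p where p: "polynomial_function p" "\<And>z. z \<in> sphere 0 1 \<Longrightarrow> cmod (G z - p z) < e"
      using Stone_Weierstrass_polynomial_function[OF compact_sphere G e] by blast
    note tp = trig_polynomial_function[OF p(1)]
    have ip: "integrable IM (\<lambda>x. f x * p (chr 1 x))"
      by (intro L2_integrable_mult f L2_trig_poly tp)
    have "(LINT x|IM. f x * G (chr 1 x)) = (LINT x|IM. f x * (G (chr 1 x) - p (chr 1 x)))"
      using trig_poly_orthogonal[OF tp f 0] int ip by (simp add: right_diff_distrib)
    also have "cmod \<dots> \<le> (LINT x|IM. cmod (f x * (G (chr 1 x) - p (chr 1 x))))"
      by (rule integral_norm_bound)
    also have "\<dots> \<le> (LINT x|IM. e * cmod (f x))"
    proof (rule integral_mono)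
      show "integrable IM (\<lambda>x. cmod (f x * (G (chr 1 x) - p (chr 1 x))))"
        using int ip by (simp add: right_diff_distrib)
      fix x
      show "cmod (f x * (G (chr 1 x) - p (chr 1 x))) \<le> e * cmod (f x)"
        using p(2)[of "chr 1 x"] by (simp add: norm_mult mult.commute[of "cmod (f x)"] mult_right_mono)
    qed (use f1 in simp)
    finally show ?thesis by simp
  qed
  have "((\<lambda>e. e * (LINT x|IM. cmod (f x))) \<longlongrightarrow> 0 * (LINT x|IM. cmod (f x))) (at_right 0)"
    by (intro tendsto_intros)
  then have "cmod (LINT x|IM. f x * G (chr 1 x)) \<le> 0 * (LINT x|IM. cmod (f x))"
    by (rule tendsto_lowerbound) (auto intro!: eventually_at_rightI[of 0 1] bound)
  then show ?thesis by simp
qed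

text \<open>A function orthogonal to all characters is orthogonal to every continuous function on the circle, by
  Stone-Weierstrass. The unimodular function \<open>h = cnj (sgn f)\<close> is an almost everywhere limit of
  continuous functions \<open>\<phi> n\<close>; truncating these and multiplying by a cutoff that vanishes at \<open>-1\<close>,
  where \<open>Arg\<close> jumps, keeps them bounded and continuous on the circle. Hence the integral of
  \<open>f * h = \<bar>f\<bar>\<close> vanishes by dominated convergence.\<close>

lemma fcoeff_zero_imp_AE_zero:
  assumes f: "L2 f" and 0: "\<And>n. fcoeff f n = 0"
  shows "AE x in IM. f x = 0"
proof -
  note [measurable] = L2_measurable[OF f]
  have f1: "integrable IM f" using L2_integrable_mult[OF f L2_const[of 1]] by simp
  define h where "h x = cnj (sgn (f x))" for x
  have h_le: "cmod (h x) \<le> 1" for x by (simp add: h_def norm_sgn)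
  have fh: "f x * h x = cmod (f x)" for x
  proof (cases "f x = 0")
    case False
    have "f x * h x = complex_of_real (cmod (f x)) * complex_of_real (cmod (f x)) / complex_of_real (cmod (f x))"
      using complex_norm_square[of "f x"] by (simp add: h_def sgn_eq power2_eq_square)
    then show ?thesis using False by simp
  qed simp
  have hm: "h \<in> borel_measurable IM"
  proof -
    have "(\<lambda>x. cnj (f x / complex_of_real (cmod (f x)))) \<in> borel_measurable IM"
      by (rule cnj_measurable) measurable
    then show ?thesis by (simp add: h_def[abs_def] sgn_eq)
  qed
  \<comment> \<open>\<open>measurable_on\<close> means by definition being an almost everywhere
    limit of continuous functions, which is the approximation wanted here.\<close>
  have "h measurable_on {-1/2..1/2}"
    using hm unfolding IM_def by (subst measurable_on_iff_borel_measurable) auto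
  obtain N \<phi> where N: "negligible N" and \<phi>: "\<And>n. continuous_on UNIV (\<phi> n)"
    and lim: "\<And>x. x \<notin> N \<Longrightarrow> x \<in> {-1/2..1/2} \<Longrightarrow> (\<lambda>n. \<phi> n x) \<longlonglongrightarrow> h x"
  proof -
    obtain N \<phi> where *: "negligible N" "\<forall>n. continuous_on UNIV (\<phi> n)"
      "\<forall>x. x \<notin> N \<longrightarrow> (\<lambda>n. \<phi> n x) \<longlonglongrightarrow> (if x \<in> {-1/2..1/2} then h x else 0)"
      using \<open>h measurable_on _\<close> unfolding measurable_on_def by blast
    show thesis
    proof (rule that[of N \<phi>])
      fix x assume "x \<notin> N" "x \<in> {-1/2..1/2::real}"
      then show "(\<lambda>n. \<phi> n x) \<longlonglongrightarrow> h x" using *(3)[rule_format, of x] by simp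
    qed (use * in auto)
  qed
  define clip where "clip z = z / complex_of_real (max 1 (cmod z))" for z
  have clip_cont: "continuous_on S clip" for S
    unfolding clip_def by (intro continuous_intros) (auto simp: max_def)
  have clip_le: "cmod (clip z) \<le> 1" for z
    by (simp add: clip_def norm_divide field_simps max_def)
  \<comment> \<open>\<open>Arg z / (2 * pi)\<close> inverts \<open>chr 1\<close> on the open
    interval, so \<open>G n\<close> carries \<open>\<phi> n\<close> over to the circle. The second
    factor equals 1 for all large \<open>n\<close> at every point other than -1.\<close>
  define G where "G n z = clip (\<phi> n (Arg z / (2 * pi))) * complex_of_real (min 1 (real n * cmod (z + 1)))" for n z
  have G_le: "cmod (G n z) \<le> 1" for n z
  proof -
    have "cmod (G n z) \<le> 1 * 1"
      unfolding G_def norm_mult by (intro mult_mono clip_le) auto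
    then show ?thesis by simp
  qed
  have G_cont: "continuous_on (sphere 0 1) (G n)" for n
    unfolding continuous_on_eq_continuous_within
  proof
    fix z :: complex assume z: "z \<in> sphere 0 1"
    show "continuous (at z within sphere 0 1) (G n)"
    proof (cases "z = -1")
      case False
      have "z \<notin> \<real>\<^sub>\<le>\<^sub>0"
        using z False by (auto simp: complex_nonpos_Reals_iff cmod_def complex_eq_iff real_sqrt_eq_1_iff power2_eq_1_iff)
      then have "isCont Arg z" by (rule continuous_at_Arg)
      then have "isCont (\<lambda>z. Arg z / (2 * pi)) z" by (intro continuous_intros) auto
      moreover have "isCont (\<phi> n) (Arg z / (2 * pi))"
        using \<phi>[of n] by (simp add: continuous_on_eq_continuous_at)
      ultimately have "isCont (\<lambda>z. \<phi> n (Arg z / (2 * pi))) z" by (rule isCont_o2)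
      moreover have "isCont clip (\<phi> n (Arg z / (2 * pi)))"
        using clip_cont[of UNIV] by (simp add: continuous_on_eq_continuous_at)
      ultimately have "isCont (\<lambda>z. clip (\<phi> n (Arg z / (2 * pi)))) z" by (rule isCont_o2)
      then have "isCont (G n) z"
        unfolding G_def by (intro continuous_intros)
      then show ?thesis by (rule continuous_at_imp_continuous_at_within)
    next
      case True
      have "((\<lambda>w. complex_of_real (min 1 (real n * cmod (w + 1)))) \<longlongrightarrow> complex_of_real (min 1 (real n * cmod (z + 1)))) (at z)"
        by (intro tendsto_intros)
      then have "((\<lambda>w. complex_of_real (min 1 (real n * cmod (w + 1)))) \<longlongrightarrow> 0) (at z)"
        using True by simp
      then have "(G n \<longlongrightarrow> 0) (at z)"
      proof (rule Lim_null_comparison[rotated, OF tendsto_norm_zero])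
        show "\<forall>\<^sub>F w in at z. cmod (G n w) \<le> cmod (complex_of_real (min 1 (real n * cmod (w + 1))))"
          unfolding G_def norm_mult by (intro always_eventually allI mult_left_le_one_le clip_le) auto
      qed
      moreover have "G n z = 0" by (simp add: G_def True)
      ultimately have "isCont (G n) z" by (simp add: isCont_def)
      then show ?thesis by (rule continuous_at_imp_continuous_at_within)
    qed
  qed
  have Gm: "(\<lambda>x. G n (chr 1 x)) \<in> borel_measurable IM" for n
  proof -
    have "continuous_on UNIV (\<lambda>x. G n (chr 1 x))"
      by (rule continuous_on_compose2[OF G_cont continuous_on_chr]) auto
    then show ?thesis by (rule continuous_measurable_IM)
  qed
  have lim0: "(LINT x|IM. f x * G n (chr 1 x)) = 0" for n
    by (rule continuous_circle_orthogonal[OF G_cont f 0 Gm])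
  have "(\<lambda>n. LINT x|IM. f x * G n (chr 1 x)) \<longlonglongrightarrow> (LINT x|IM. f x * h x)"
  proof (rule integral_dominated_convergence)
    show "integrable IM (\<lambda>x. cmod (f x))" using f1 by simp
    show "AE x in IM. cmod (f x * G n (chr 1 x)) \<le> cmod (f x)" for n
      using G_le by (auto simp: norm_mult intro!: AE_I2 mult_right_le_one_le)
    \<comment> \<open>Both end points are mapped to -1, where the cutoff is 0 for every
      \<open>n\<close>; they are discarded together with the null set \<open>N\<close>.\<close>
    have ae: "AE x in IM. x \<notin> N \<union> {-1/2, 1/2}"
    proof -
      have "negligible (N \<union> {-1/2, 1/2})" using N by (intro negligible_Un) auto
      then have "N \<union> {-1/2, 1/2} \<in> null_sets lebesgue" by (simp add: negligible_iff_null_sets)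
      then have "AE x in lebesgue. x \<notin> N \<union> {-1/2, 1/2}" by (rule AE_not_in)
      then show ?thesis unfolding IM_def by (subst AE_restrict_space_iff) (auto elim: eventually_mono)
    qed
    have sp: "AE x in IM. x \<in> {-1/2..1/2}" using AE_space[of IM] by (simp add: space_IM)
    show "AE x in IM. (\<lambda>n. f x * G n (chr 1 x)) \<longlonglongrightarrow> f x * h x"
      using ae sp
    proof eventually_elim
      case (elim x)
      have x: "-1/2 < x" "x < 1/2" "x \<notin> N" using elim by auto
      have Arg: "Arg (chr 1 x) = 2 * pi * x"
      proof (rule Arg_unique[of 1])
        show "- pi < 2 * pi * x" "2 * pi * x \<le> pi"
          using mult_strict_left_mono[OF x(1) pi_gt_zero] mult_strict_left_mono[OF x(2) pi_gt_zero] by auto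
      qed (auto simp: chr_def)
      have ne: "chr 1 x + 1 \<noteq> 0"
      proof
        assume "chr 1 x + 1 = 0"
        then have "chr 1 x = -1" by (simp add: add_eq_0_iff2)
        then have "2 * pi * x = pi" using Arg Arg_eq_pi[of "-1"] by simp
        then show False using x by simp
      qed
      have "(\<lambda>n. clip (\<phi> n x)) \<longlonglongrightarrow> clip (h x)"
        using clip_cont[of UNIV] lim[of x] elim
        by (intro isCont_tendsto_compose[of _ clip]) (auto simp: continuous_on_eq_continuous_at)
      moreover have "clip (h x) = h x" using h_le[of x] by (simp add: clip_def max_def)
      moreover have "(\<lambda>n. complex_of_real (min 1 (real n * cmod (chr 1 x + 1)))) \<longlonglongrightarrow> 1"
      proof (rule tendsto_eventually)
        obtain m :: nat where m: "1 / cmod (chr 1 x + 1) < real m" using reals_Archimedean2 by blast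
        show "\<forall>\<^sub>F n in sequentially. complex_of_real (min 1 (real n * cmod (chr 1 x + 1))) = 1"
        proof (rule eventually_sequentiallyI[of m])
          fix n assume "m \<le> n"
          then have "1 / cmod (chr 1 x + 1) < real n" using m by linarith
          then have "1 \<le> real n * cmod (chr 1 x + 1)" using ne by (simp add: field_simps)
          then show "complex_of_real (min 1 (real n * cmod (chr 1 x + 1))) = 1" by (simp add: min_def)
        qed
      qed
      ultimately have "(\<lambda>n. clip (\<phi> n x) * complex_of_real (min 1 (real n * cmod (chr 1 x + 1)))) \<longlonglongrightarrow> h x * 1"
        by (intro tendsto_mult) auto
      then show ?case by (intro tendsto_intros) (simp add: G_def Arg)
    qed
  qed (use hm Gm in measurable)
  then have "(LINT x|IM. f x * h x) = 0"
    by (simp add: lim0 LIMSEQ_const_iff)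
  then have "complex_of_real (LINT x|IM. cmod (f x)) = 0"
    by (simp add: fh flip: integral_complex_of_real)
  then have "(LINT x|IM. cmod (f x)) = 0" by simp
  then have "AE x in IM. cmod (f x) = 0" using f1 integral_nonneg_eq_0_iff_AE[of IM "\<lambda>x. cmod (f x)"] by simp
  then show ?thesis by simp
qed

lemma fcoeff_eq_imp_AE_eq:
  assumes "L2 f" "L2 h" "\<And>n. fcoeff f n = fcoeff h n"
  shows "AE x in IM. f x = h x"
  using fcoeff_zero_imp_AE_zero[OF L2_diff[OF assms(1,2)]] assms by (simp add: fcoeff_diff)

section \<open>The Riesz-Fischer theorem and Parseval's identity\<close>

text \<open>The partial sums are Cauchy in L1, so a subsequence converges almost everywhere. Fatou's
  lemma along that subsequence bounds the squared distance of the limit from every partial sum, not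
  only from those of the subsequence, by the tail \<open>S - A N\<close>.\<close>

lemma Riesz_Fischer:
  fixes a :: "int \<Rightarrow> complex"
  assumes a: "(\<lambda>k. (cmod (a k))\<^sup>2) summable_on UNIV"
  obtains u where "L2 u" "\<And>k. fcoeff u k = a k"
    "(\<lambda>N. l2_normsq (\<lambda>x. u x - trig_sum a {- int N..int N} x)) \<longlonglongrightarrow> 0"
proof -
  define I where "I N = {- int N..int N}" for N
  define s where "s N = trig_sum a (I N)" for N
  define A where "A N = (\<Sum>k\<in>I N. (cmod (a k))\<^sup>2)" for N
  have I_mono: "I i \<subseteq> I j" if "i \<le> j" for i j using that by (auto simp: I_def)
  have finI [simp]: "finite (I N)" for N by (simp add: I_def)
  have s_L2 [simp]: "L2 (s N)" for N by (simp add: s_def)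
  note [measurable] = L2_measurable[OF s_L2]
  have nsq_s: "l2_normsq (\<lambda>x. s j x - s i x) = A j - A i" if "i \<le> j" for i j
  proof -
    have "(\<lambda>x. s j x - s i x) = trig_sum a (I j - I i)"
      by (rule ext) (simp add: s_def sum_diff I_mono[OF that])
    then have "l2_normsq (\<lambda>x. s j x - s i x) = (\<Sum>k\<in>I j - I i. (cmod (a k))\<^sup>2)"
      by (simp only: l2_normsq_trig_sum finI finite_Diff)
    then show ?thesis by (simp add: A_def sum_diff I_mono[OF that])
  qed
  have "incseq A"
    unfolding A_def by (intro incseq_SucI sum_mono2) (auto simp: I_def)
  moreover have "A N \<le> (\<Sum>\<^sub>\<infinity>k. (cmod (a k))\<^sup>2)" for N
    unfolding A_def by (rule finite_sum_le_infsum[OF a]) auto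
  ultimately obtain S where S: "A \<longlonglongrightarrow> S" "\<And>N. A N \<le> S"
    using incseq_convergent by blast
  have nsq_abs: "l2_normsq (\<lambda>x. s i x - s j x) = \<bar>A i - A j\<bar>" for i j
  proof (cases "i \<le> j")
    case True
    have "l2_normsq (\<lambda>x. s i x - s j x) = l2_normsq (\<lambda>x. s j x - s i x)"
      by (simp add: l2_normsq_def norm_minus_commute)
    then show ?thesis using nsq_s[OF True] l2_normsq_nonneg[of "\<lambda>x. s j x - s i x"] by linarith
  next
    case False
    then show ?thesis using nsq_s[of j i] l2_normsq_nonneg[of "\<lambda>x. s i x - s j x"] by linarith
  qed
  \<comment> \<open>The interval has measure 1, so pairing with the constant 1 dominates the L1 norm
    by the L2 norm; the subsequence lemma asks for an L1 Cauchy sequence.\<close>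
  have L1: "(LINT x|IM. cmod (s i x - s j x)) \<le> sqrt \<bar>A i - A j\<bar>" for i j
    using L2_Cauchy_Schwarz_abs[OF L2_diff[OF s_L2 s_L2] L2_const[of 1], of i j] measure_IM
    by (simp add: nsq_abs l2_normsq_def[of "\<lambda>x. 1"])
  obtain r where r: "strict_mono r" "AE x in IM. Cauchy (\<lambda>i. s (r i) x)"
  proof (rule cauchy_L1_AE_cauchy_subseq[of IM s])
    show "integrable IM (s n)" for n using L2_integrable_mult[OF s_L2 L2_const[of 1]] by simp
    fix e :: real assume e: "e > 0"
    obtain N where N: "\<And>i j. i \<ge> N \<Longrightarrow> j \<ge> N \<Longrightarrow> dist (A i) (A j) < e\<^sup>2"
      using LIMSEQ_imp_Cauchy[OF S(1)] e unfolding Cauchy_def by (metis zero_less_power)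
    show "\<exists>N. \<forall>i\<ge>N. \<forall>j\<ge>N. (LINT x|IM. cmod (s i x - s j x)) < e"
    proof (intro exI allI impI)
      fix i j assume "N \<le> i" "N \<le> j"
      then have "sqrt \<bar>A i - A j\<bar> < sqrt (e\<^sup>2)"
        using N by (intro real_sqrt_less_mono) (auto simp: dist_real_def)
      then show "(LINT x|IM. cmod (s i x - s j x)) < e" using L1[of i j] e by simp
    qed
  qed
  define u where "u x = lim (\<lambda>i. s (r i) x)" for x
  have u_meas [measurable]: "u \<in> borel_measurable IM"
    unfolding u_def by (rule borel_measurable_lim_metric) measurable
  have lim: "AE x in IM. (\<lambda>i. s (r i) x) \<longlonglongrightarrow> u x"
    using r(2) by eventually_elim (simp add: u_def Cauchy_convergent convergent_LIMSEQ_iff[symmetric])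
  have Fatou: "(\<integral>\<^sup>+x. ennreal ((cmod (u x - s N x))\<^sup>2) \<partial>IM) \<le> ennreal (S - A N)" for N
  proof -
    have "(\<integral>\<^sup>+x. ennreal ((cmod (u x - s N x))\<^sup>2) \<partial>IM) =
        (\<integral>\<^sup>+x. liminf (\<lambda>i. ennreal ((cmod (s (r i) x - s N x))\<^sup>2)) \<partial>IM)"
    proof (rule nn_integral_cong_AE)
      show "AE x in IM. ennreal ((cmod (u x - s N x))\<^sup>2) = liminf (\<lambda>i. ennreal ((cmod (s (r i) x - s N x))\<^sup>2))"
        using lim
      proof eventually_elim
        case (elim x)
        then have "(\<lambda>i. ennreal ((cmod (s (r i) x - s N x))\<^sup>2)) \<longlonglongrightarrow> ennreal ((cmod (u x - s N x))\<^sup>2)"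
          by (intro tendsto_intros)
        then show ?case by (rule lim_imp_Liminf[OF trivial_limit_sequentially, symmetric])
      qed
    qed
    also have "\<dots> \<le> liminf (\<lambda>i. \<integral>\<^sup>+x. ennreal ((cmod (s (r i) x - s N x))\<^sup>2) \<partial>IM)"
      by (rule nn_integral_liminf) measurable
    also have "\<dots> \<le> ennreal (S - A N)"
    proof (rule Liminf_le)
      show "\<forall>\<^sub>F i in sequentially. (\<integral>\<^sup>+x. ennreal ((cmod (s (r i) x - s N x))\<^sup>2) \<partial>IM) \<le> ennreal (S - A N)"
      proof (rule eventually_sequentiallyI[of N])
        fix i assume "N \<le> i"
        then have "N \<le> r i" using seq_suble[OF r(1), of i] by linarith
        have "(\<integral>\<^sup>+x. ennreal ((cmod (s (r i) x - s N x))\<^sup>2) \<partial>IM) = ennreal (l2_normsq (\<lambda>x. s (r i) x - s N x))"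
          unfolding l2_normsq_def
          using L2_diff[OF s_L2 s_L2] by (intro nn_integral_eq_integral) (auto simp: L2_def)
        also have "\<dots> \<le> ennreal (S - A N)"
          using nsq_s[OF \<open>N \<le> r i\<close>] S(2)[of "r i"] by (intro ennreal_leI) simp
        finally show "(\<integral>\<^sup>+x. ennreal ((cmod (s (r i) x - s N x))\<^sup>2) \<partial>IM) \<le> ennreal (S - A N)" .
      qed
    qed simp
    finally show ?thesis .
  qed
  have uN: "L2 (\<lambda>x. u x - s N x)" for N
    unfolding L2_def
  proof
    show "integrable IM (\<lambda>x. (cmod (u x - s N x))\<^sup>2)"
      using Fatou[of N] by (intro integrableI_bounded) (auto simp: le_less_trans)
  qed measurable
  have u: "L2 u" using L2_add[OF uN[of 0] s_L2[of 0]] by simp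
  have uN_le: "l2_normsq (\<lambda>x. u x - s N x) \<le> S - A N" for N
  proof -
    have "ennreal (l2_normsq (\<lambda>x. u x - s N x)) = (\<integral>\<^sup>+x. ennreal ((cmod (u x - s N x))\<^sup>2) \<partial>IM)"
      unfolding l2_normsq_def
      using uN by (intro nn_integral_eq_integral[symmetric]) (auto simp: L2_def)
    with Fatou[of N] have "ennreal (l2_normsq (\<lambda>x. u x - s N x)) \<le> ennreal (S - A N)" by (simp only:)
    then show ?thesis using S(2)[of N] by (subst (asm) ennreal_le_iff) auto
  qed
  have "(\<lambda>N. S - A N) \<longlonglongrightarrow> S - S" by (intro tendsto_intros S)
  then have S0: "(\<lambda>N. S - A N) \<longlonglongrightarrow> 0" by simp
  have conv: "(\<lambda>N. l2_normsq (\<lambda>x. u x - s N x)) \<longlonglongrightarrow> 0"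
    by (rule tendsto_sandwich[OF _ _ tendsto_const S0]) (auto intro!: always_eventually uN_le)
  have "fcoeff u k = a k" for k
  proof (rule LIMSEQ_unique)
    show "(\<lambda>N. fcoeff (s N) k) \<longlonglongrightarrow> fcoeff u k"
      unfolding fcoeff_inner by (rule l2_inner_tendsto[OF s_L2 u L2_chr conv])
    have "\<forall>\<^sub>F N in sequentially. fcoeff (s N) k = a k"
      by (rule eventually_sequentiallyI[of "nat \<bar>k\<bar>"]) (auto simp: s_def fcoeff_trig_sum I_def)
    then show "(\<lambda>N. fcoeff (s N) k) \<longlonglongrightarrow> a k" by (rule tendsto_eventually)
  qed
  then show thesis using that u conv by (simp add: s_def I_def)
qed

text \<open>Bessel gives one inequality. For the other, the function that Riesz-Fischer builds from
  the coefficients of \<open>f\<close> agrees with \<open>f\<close> almost everywhere by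
  completeness of the characters, so the Bessel defect tends to 0 along symmetric sums.\<close>

lemma Parseval:
  assumes f: "L2 f"
  shows "((\<lambda>k. (cmod (fcoeff f k))\<^sup>2) has_sum l2_normsq f) UNIV"
proof -
  note sm = fcoeff_square_summable[OF f, of UNIV]
  obtain u where u: "L2 u" "\<And>k. fcoeff u k = fcoeff f k"
    "(\<lambda>N. l2_normsq (\<lambda>x. u x - trig_sum (fcoeff f) {- int N..int N} x)) \<longlonglongrightarrow> 0"
    using Riesz_Fischer[OF sm] by blast
  have coeff: "fcoeff u = fcoeff f" using u(2) by auto
  have ae: "AE x in IM. u x = f x" by (rule fcoeff_eq_imp_AE_eq[OF u(1) f u(2)])
  let ?S = "\<Sum>\<^sub>\<infinity>k. (cmod (fcoeff f k))\<^sup>2"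
  have "(\<lambda>N. l2_normsq f - (\<Sum>k\<in>{- int N..int N}. (cmod (fcoeff f k))\<^sup>2)) \<longlonglongrightarrow> 0"
    using u(3) Bessel_identity[OF u(1)] l2_normsq_cong[OF ae u(1) f] by (simp add: coeff)
  moreover have "l2_normsq f - ?S \<le> l2_normsq f - (\<Sum>k\<in>{- int N..int N}. (cmod (fcoeff f k))\<^sup>2)" for N
    using finite_sum_le_infsum[OF sm, of "{- int N..int N}"] by simp
  ultimately have "l2_normsq f - ?S \<le> 0"
    by (intro LIMSEQ_le_const) auto
  moreover have "?S \<le> l2_normsq f"
    by (rule infsum_le_finite_sums[OF sm]) (use Bessel_inequality[OF f] in auto)
  ultimately show ?thesis using has_sum_infsum[OF sm] by simp
qed

text \<open>Upgrades symmetric sums to the net of all finite index sets, the mode of convergence in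
  \<open>L2_expansion\<close>; the square sums converge in that mode because they are a
  \<open>has_sum\<close>.\<close>

lemma Fourier_series_tendsto:
  assumes f: "L2 f"
  shows "((\<lambda>F. l2_normsq (\<lambda>x. f x - trig_sum (fcoeff f) F x)) \<longlongrightarrow> 0) (finite_subsets_at_top UNIV)"
proof -
  have "((\<lambda>F. l2_normsq f - (\<Sum>k\<in>F. (cmod (fcoeff f k))\<^sup>2)) \<longlongrightarrow> l2_normsq f - l2_normsq f) (finite_subsets_at_top UNIV)"
    using Parseval[OF f] unfolding has_sum_def by (intro tendsto_intros)
  moreover have "\<forall>\<^sub>F F in finite_subsets_at_top UNIV.
      l2_normsq f - (\<Sum>k\<in>F. (cmod (fcoeff f k))\<^sup>2) = l2_normsq (\<lambda>x. f x - trig_sum (fcoeff f) F x)"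
    by (rule eventually_finite_subsets_at_top_weakI) (simp add: Bessel_identity[OF f])
  ultimately show ?thesis by (simp add: tendsto_cong)
qed

lemma l2_inner_has_sum:
  assumes f: "L2 f" and h: "L2 h"
  shows "((\<lambda>k. fcoeff f k * cnj (fcoeff h k)) has_sum l2_inner f h) UNIV"
  using l2_inner_tendsto[OF L2_trig_sum f h Fourier_series_tendsto[OF f]]
  unfolding has_sum_def l2_inner_trig_sum[OF h] .

section \<open>Square-summable sequences and Toeplitz operators\<close>

lemma has_sum_int_nat:
  fixes \<phi> :: "int \<Rightarrow> 'a::{topological_comm_monoid_add, t2_space}"
  assumes "\<And>n. n < 0 \<Longrightarrow> \<phi> n = 0"
  shows "((\<lambda>k. \<phi> (int k)) has_sum s) UNIV \<longleftrightarrow> (\<phi> has_sum s) UNIV"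
proof -
  have "((\<lambda>k. \<phi> (int k)) has_sum s) UNIV \<longleftrightarrow> (\<phi> has_sum s) (range int)"
    by (simp add: has_sum_reindex[of int UNIV \<phi>] o_def inj_on_def)
  also have "\<dots> \<longleftrightarrow> (\<phi> has_sum s) UNIV"
  proof (rule has_sum_cong_neutral)
    fix n assume "n \<in> UNIV - range int"
    then have "n < 0" using zero_le_imp_eq_int[of n] by (cases "n < 0") auto
    then show "\<phi> n = 0" by (rule assms)
  qed auto
  finally show ?thesis .
qed

section \<open>The norm of square-summable sequences and their Hardy functions\<close>

lemma ell2_norm_nonneg: "0 \<le> ell2_norm c"
  unfolding ell2_norm_def by (simp add: infsum_nonneg)

lemma ell2_norm_square: "(ell2_norm c)\<^sup>2 = (\<Sum>\<^sub>\<infinity>k. (cmod (c k))\<^sup>2)"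
  unfolding ell2_norm_def by (simp add: infsum_nonneg)

lemma ell2_has_sum: "ell2 c \<Longrightarrow> ((\<lambda>k. (cmod (c k))\<^sup>2) has_sum (ell2_norm c)\<^sup>2) UNIV"
  unfolding ell2_norm_square ell2_def by (rule has_sum_infsum)

lemma ell2_component_le:
  assumes "ell2 c"
  shows "cmod (c k) \<le> ell2_norm c"
proof -
  have "(cmod (c k))\<^sup>2 \<le> (ell2_norm c)\<^sup>2"
    using finite_sum_le_infsum[of "\<lambda>k. (cmod (c k))\<^sup>2" UNIV "{k}"] assms
    by (simp add: ell2_norm_square ell2_def)
  then show ?thesis using ell2_norm_nonneg by (rule power2_le_imp_le)
qed

lemma ell2_bounded_partial_sums:
  assumes "\<And>F. finite F \<Longrightarrow> (\<Sum>k\<in>F. (cmod (c k))\<^sup>2) \<le> B\<^sup>2" "0 \<le> B"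
  shows "ell2 c" "ell2_norm c \<le> B"
proof -
  show c: "ell2 c"
    unfolding ell2_def by (rule nonneg_bdd_above_summable_on) (auto intro!: bdd_aboveI2[of _ _ "B\<^sup>2"] assms)
  have "(ell2_norm c)\<^sup>2 \<le> B\<^sup>2"
    unfolding ell2_norm_square using c assms by (intro infsum_le_finite_sums) (auto simp: ell2_def)
  then show "ell2_norm c \<le> B" using assms(2) by (rule power2_le_imp_le)
qed

lemma ell2_zero [simp]: "ell2 (\<lambda>_. 0)"
  by (simp add: ell2_def)

lemma ell2_norm_zero [simp]: "ell2_norm (\<lambda>_. 0) = 0"
  by (simp add: ell2_norm_def)

lemma ell2_cnj [simp]: "ell2 (\<lambda>k. cnj (c k)) \<longleftrightarrow> ell2 c"
  by (simp add: ell2_def)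

text \<open>The isometry between sequences and functions without negative frequencies, kept as a
  relation because the function is determined only almost everywhere.\<close>

definition hardy :: "(nat \<Rightarrow> complex) \<Rightarrow> (real \<Rightarrow> complex) \<Rightarrow> bool" where
  "hardy c u \<longleftrightarrow> L2 u \<and> (\<forall>k. fcoeff u (int k) = c k) \<and> (\<forall>n<0. fcoeff u n = 0)"

lemma hardy_exists:
  assumes "ell2 c"
  obtains u where "hardy c u"
proof -
  define a where "a n = (if n < 0 then 0 else c (nat n))" for n
  have "((\<lambda>n. (cmod (a n))\<^sup>2) has_sum (ell2_norm c)\<^sup>2) UNIV"
    using ell2_has_sum[OF assms] has_sum_int_nat[of "\<lambda>n. (cmod (a n))\<^sup>2"] by (simp add: a_def)
  then obtain u where "L2 u" "\<And>n. fcoeff u n = a n"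
    using Riesz_Fischer has_sum_imp_summable by metis
  then have "hardy c u" by (simp add: hardy_def a_def)
  then show thesis by (rule that)
qed

lemma hardy_L2: "hardy c u \<Longrightarrow> L2 u"
  by (simp add: hardy_def)

lemma hardy_normsq:
  assumes "hardy c u"
  shows "l2_normsq u = (ell2_norm c)\<^sup>2"
proof -
  have "((\<lambda>k. (cmod (fcoeff u (int k)))\<^sup>2) has_sum l2_normsq u) UNIV"
    using Parseval[OF hardy_L2[OF assms]] assms
    by (subst has_sum_int_nat[of "\<lambda>n. (cmod (fcoeff u n))\<^sup>2"]) (auto simp: hardy_def)
  then show ?thesis using assms by (simp add: hardy_def ell2_norm_square infsumI)
qed

lemma hardy_diff: "hardy c u \<Longrightarrow> hardy d v \<Longrightarrow> hardy (\<lambda>k. c k - d k) (\<lambda>x. u x - v x)"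
  by (simp add: hardy_def L2_diff fcoeff_diff)

lemma hardy_cmult: "hardy c u \<Longrightarrow> hardy (\<lambda>k. t * c k) (\<lambda>x. t * u x)"
  by (simp add: hardy_def L2_cmult fcoeff_inner l2_inner_cmult)

text \<open>Bessel's inequality along an injective reindexing; it serves both the nonnegative half
  (\<open>int\<close>) and the negative half (\<open>\<lambda>k. - 1 - int k\<close>).\<close>

lemma
  assumes f: "L2 f" and h: "inj h"
  shows ell2_fcoeff: "ell2 (\<lambda>j. fcoeff f (h j))"
    and ell2_norm_fcoeff_le: "(ell2_norm (\<lambda>j. fcoeff f (h j)))\<^sup>2 \<le> l2_normsq f"
proof -
  have "(\<Sum>j\<in>F. (cmod (fcoeff f (h j)))\<^sup>2) \<le> (sqrt (l2_normsq f))\<^sup>2" if "finite F" for F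
    using Bessel_inequality[OF f, of "h ` F"] that inj_on_subset[OF h, of F]
    by (simp add: sum.reindex)
  from ell2_bounded_partial_sums[OF this]
  have *: "ell2 (\<lambda>j. fcoeff f (h j))" "ell2_norm (\<lambda>j. fcoeff f (h j)) \<le> sqrt (l2_normsq f)" by simp_all
  then show "ell2 (\<lambda>j. fcoeff f (h j))" by simp
  show "(ell2_norm (\<lambda>j. fcoeff f (h j)))\<^sup>2 \<le> l2_normsq f"
    using power_mono[OF *(2) ell2_norm_nonneg, of 2] by simp
qed

lemma hardy_ell2: "hardy c u \<Longrightarrow> ell2 c"
  using ell2_fcoeff[of u int] by (simp add: hardy_def inj_def)

lemma ell2_diff: "ell2 c \<Longrightarrow> ell2 d \<Longrightarrow> ell2 (\<lambda>k. c k - d k)"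
  using hardy_diff hardy_ell2 by (metis hardy_exists)

lemma ell2_cmult: "ell2 c \<Longrightarrow> ell2 (\<lambda>k. t * c k)"
  using hardy_cmult hardy_ell2 by (metis hardy_exists)

text \<open>Transported from functions, where Cauchy-Schwarz is available: \<open>hardy\<close>
  turns sequence norms into function norms.\<close>

lemma ell2_norm_triangle_diff:
  assumes "ell2 c" "ell2 d"
  shows "ell2_norm (\<lambda>k. c k - d k) \<le> ell2_norm c + ell2_norm d"
proof -
  obtain u v where u: "hardy c u" and v: "hardy d v" using assms hardy_exists by metis
  have "- Re (l2_inner u v) \<le> ell2_norm c * ell2_norm d"
    using L2_Cauchy_Schwarz[OF hardy_L2[OF u] hardy_L2[OF v]] abs_Re_le_cmod[of "l2_inner u v"]
    by (simp add: hardy_normsq[OF u] hardy_normsq[OF v] ell2_norm_nonneg)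
  then have "(ell2_norm (\<lambda>k. c k - d k))\<^sup>2 \<le> (ell2_norm c + ell2_norm d)\<^sup>2"
    using l2_normsq_diff[OF hardy_L2[OF u] hardy_L2[OF v]]
    by (simp add: hardy_normsq[OF u] hardy_normsq[OF v] hardy_normsq[OF hardy_diff[OF u v]] power2_sum)
  then show ?thesis by (rule power2_le_imp_le) (simp add: ell2_norm_nonneg)
qed

section \<open>Square-summable sequences as a complete metric space\<close>

lemma ell2_norm_minus_commute: "ell2_norm (\<lambda>k. c k - d k) = ell2_norm (\<lambda>k. d k - c k)"
  by (simp add: ell2_norm_def norm_minus_commute)

lemma ell2_Metric_space: "Metric_space (Collect ell2) (\<lambda>c d. ell2_norm (\<lambda>k. c k - d k))"
proof
  show "0 \<le> ell2_norm (\<lambda>k. c k - d k)" for c d by (rule ell2_norm_nonneg)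
  show "ell2_norm (\<lambda>k. c k - d k) = ell2_norm (\<lambda>k. d k - c k)" for c d by (rule ell2_norm_minus_commute)
  show "ell2_norm (\<lambda>k. c k - d k) = 0 \<longleftrightarrow> c = d" if "c \<in> Collect ell2" "d \<in> Collect ell2" for c d
  proof
    assume "ell2_norm (\<lambda>k. c k - d k) = 0"
    then have "cmod (c k - d k) \<le> 0" for k
      using ell2_component_le[OF ell2_diff, of c d k] that by simp
    then show "c = d" by auto
  qed simp
  show "ell2_norm (\<lambda>k. c k - e k) \<le> ell2_norm (\<lambda>k. c k - d k) + ell2_norm (\<lambda>k. d k - e k)"
    if "c \<in> Collect ell2" "d \<in> Collect ell2" "e \<in> Collect ell2" for c d e
    using ell2_norm_triangle_diff[of "\<lambda>k. c k - d k" "\<lambda>k. e k - d k"] that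
    by (simp add: ell2_diff ell2_norm_minus_commute[of d e])
qed

text \<open>Makes Banach's fixed point theorem applicable. The limit is taken componentwise, and the
  Cauchy bound survives because it has to be checked on finite partial sums only, where passing to
  the limit is harmless.\<close>

lemma ell2_mcomplete: "Metric_space.mcomplete (Collect ell2) (\<lambda>c d. ell2_norm (\<lambda>k. c k - d k))"
proof -
  interpret Metric_space "Collect ell2" "\<lambda>c d. ell2_norm (\<lambda>k. c k - d k)" by (rule ell2_Metric_space)
  show ?thesis
    unfolding mcomplete_def
  proof (intro allI impI)
    fix \<sigma> assume "MCauchy \<sigma>"
    then have \<sigma>: "ell2 (\<sigma> n)" and C: "\<exists>N. \<forall>n n'. N \<le> n \<longrightarrow> N \<le> n' \<longrightarrow> ell2_norm (\<lambda>k. \<sigma> n k - \<sigma> n' k) < e"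
      if "e > 0" for n e
      using that unfolding MCauchy_def by blast+
    have \<sigma>: "ell2 (\<sigma> n)" for n using \<sigma>[of 1] by simp
    have "Cauchy (\<lambda>n. \<sigma> n k)" for k
    proof (rule metric_CauchyI)
      fix e :: real assume "e > 0"
      from C[OF this] obtain N where N: "\<And>n n'. N \<le> n \<Longrightarrow> N \<le> n' \<Longrightarrow> ell2_norm (\<lambda>k. \<sigma> n k - \<sigma> n' k) < e" by blast
      have "dist (\<sigma> n k) (\<sigma> n' k) < e" if "N \<le> n" "N \<le> n'" for n n'
        using N[OF that] ell2_component_le[OF ell2_diff[OF \<sigma>[of n] \<sigma>[of n']], of k] by (simp add: dist_norm)
      then show "\<exists>N. \<forall>m\<ge>N. \<forall>n\<ge>N. dist (\<sigma> m k) (\<sigma> n k) < e" by blast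
    qed
    then have conv: "convergent (\<lambda>n. \<sigma> n k)" for k by (rule Cauchy_convergent)
    define x where "x k = lim (\<lambda>n. \<sigma> n k)" for k
    have x: "(\<lambda>n. \<sigma> n k) \<longlonglongrightarrow> x k" for k
      using conv[of k] by (simp add: x_def convergent_LIMSEQ_iff)
    have close: "\<exists>N. \<forall>n\<ge>N. ell2 (\<lambda>k. \<sigma> n k - x k) \<and> ell2_norm (\<lambda>k. \<sigma> n k - x k) \<le> e" if "e > 0" for e
    proof -
      from C[OF that] obtain N where N: "\<And>n n'. N \<le> n \<Longrightarrow> N \<le> n' \<Longrightarrow> ell2_norm (\<lambda>k. \<sigma> n k - \<sigma> n' k) < e" by blast
      have "(\<Sum>k\<in>F. (cmod (\<sigma> n k - x k))\<^sup>2) \<le> e\<^sup>2" if "N \<le> n" "finite F" for n F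
      proof (rule tendsto_upperbound)
        show "((\<lambda>n'. \<Sum>k\<in>F. (cmod (\<sigma> n k - \<sigma> n' k))\<^sup>2) \<longlongrightarrow> (\<Sum>k\<in>F. (cmod (\<sigma> n k - x k))\<^sup>2)) sequentially"
          by (intro tendsto_intros x)
        show "\<forall>\<^sub>F n' in sequentially. (\<Sum>k\<in>F. (cmod (\<sigma> n k - \<sigma> n' k))\<^sup>2) \<le> e\<^sup>2"
        proof (rule eventually_sequentiallyI[of N])
          fix n' assume "N \<le> n'"
          have "(\<Sum>k\<in>F. (cmod (\<sigma> n k - \<sigma> n' k))\<^sup>2) \<le> (ell2_norm (\<lambda>k. \<sigma> n k - \<sigma> n' k))\<^sup>2"
            unfolding ell2_norm_square using ell2_diff[OF \<sigma>[of n] \<sigma>[of n']] \<open>finite F\<close>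
            by (intro finite_sum_le_infsum) (auto simp: ell2_def)
          also have "\<dots> \<le> e\<^sup>2"
            using N[OF \<open>N \<le> n\<close> \<open>N \<le> n'\<close>] by (intro power_mono ell2_norm_nonneg) simp
          finally show "(\<Sum>k\<in>F. (cmod (\<sigma> n k - \<sigma> n' k))\<^sup>2) \<le> e\<^sup>2" .
        qed
      qed simp
      from ell2_bounded_partial_sums[OF this] show ?thesis using that by (metis less_imp_le)
    qed
    obtain n where "ell2 (\<lambda>k. \<sigma> n k - x k)" using close[of 1] by auto
    from ell2_diff[OF \<sigma>[of n] this] have ex: "ell2 x" by simp
    have "limitin mtopology \<sigma> x sequentially"
      unfolding limitin_metric eventually_sequentially
    proof (intro conjI allI impI)
      fix e :: real assume "e > 0"
      from close[of "e/2"] this obtain N where N: "\<forall>n\<ge>N. ell2_norm (\<lambda>k. \<sigma> n k - x k) \<le> e / 2" by auto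
      then show "\<exists>N. \<forall>n\<ge>N. \<sigma> n \<in> Collect ell2 \<and> ell2_norm (\<lambda>k. \<sigma> n k - x k) < e"
        using \<sigma> \<open>e > 0\<close> by (intro exI[of _ N]) fastforce
    qed (simp add: ex)
    then show "\<exists>x. limitin mtopology \<sigma> x sequentially" by blast
  qed
qed

text \<open>The inner product of sequences enters as the value \<open>z\<close> of a convergent sum.
  The formula serves the contraction estimate for the normal operator, where the step size is
  real.\<close>

lemma ell2_norm_diff_square:
  assumes "ell2 c" "ell2 d" "((\<lambda>k. c k * cnj (d k)) has_sum z) UNIV"
  shows "(ell2_norm (\<lambda>k. c k - complex_of_real t * d k))\<^sup>2 =
    (ell2_norm c)\<^sup>2 - 2 * t * Re z + t\<^sup>2 * (ell2_norm d)\<^sup>2"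
proof -
  have "((\<lambda>k. (cmod (c k))\<^sup>2 + (- 2 * t) * Re (c k * cnj (d k)) + t\<^sup>2 * (cmod (d k))\<^sup>2)
      has_sum (ell2_norm c)\<^sup>2 + (- 2 * t) * Re z + t\<^sup>2 * (ell2_norm d)\<^sup>2) UNIV"
    by (intro has_sum_add has_sum_cmult_right has_sum_Re ell2_has_sum assms)
  moreover have "(cmod (c k))\<^sup>2 + (- 2 * t) * Re (c k * cnj (d k)) + t\<^sup>2 * (cmod (d k))\<^sup>2 =
      (cmod (c k - complex_of_real t * d k))\<^sup>2" for k
    by (simp add: cmod_power2) algebra
  ultimately show ?thesis by (simp add: ell2_norm_square infsumI)
qed

section \<open>Toeplitz operators as compressed multiplication operators\<close>

lemma toeplitz_eq_fcoeff:
  assumes g: "Linf g" and u: "hardy c u"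
  shows "toeplitz g c j = fcoeff (\<lambda>x. g x * u x) (int j)"
proof -
  \<comment> \<open>The coefficient of \<open>h\<close> at \<open>n\<close> is the conjugate of the
    matrix entry in row \<open>j\<close> and column \<open>n\<close>. So the row sum is the inner
    product of \<open>u\<close> with \<open>h\<close>, which also settles its convergence, and
    regrouping the integrand gives a coefficient of \<open>g * u\<close>.\<close>
  define h where "h x = chr (int j) x * cnj (g x)" for x
  have "L2 (\<lambda>x. cnj (g x) * chr (int j) x)" by (rule L2_Linf_mult[OF L2_chr Linf_cnj[OF g]])
  then have h: "L2 h" by (simp add: h_def[abs_def] mult.commute)
  have "fcoeff h n = cnj (fcoeff g (int j - n))" for n
    unfolding h_def fcoeff_chr_mult fcoeff_cnj by simp
  then have "((\<lambda>n. fcoeff u n * fcoeff g (int j - n)) has_sum l2_inner u h) UNIV"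
    using l2_inner_has_sum[OF hardy_L2[OF u] h] by simp
  then have "((\<lambda>k. fcoeff u (int k) * fcoeff g (int j - int k)) has_sum l2_inner u h) UNIV"
    using u by (subst has_sum_int_nat[of "\<lambda>n. fcoeff u n * fcoeff g (int j - n)"]) (auto simp: hardy_def)
  then have "toeplitz g c j = l2_inner u h"
    using u by (simp add: toeplitz_def hardy_def infsumI mult.commute)
  also have "\<dots> = fcoeff (\<lambda>x. g x * u x) (int j)"
    by (simp add: l2_inner_def fcoeff_def h_def algebra_simps)
  finally show ?thesis .
qed

lemma ell2_toeplitz:
  assumes g: "Linf g" and c: "ell2 c"
  shows "ell2 (toeplitz g c)"
proof -
  obtain u where u: "hardy c u" using hardy_exists[OF c] .
  have "toeplitz g c = (\<lambda>j. fcoeff (\<lambda>x. g x * u x) (int j))"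
    using toeplitz_eq_fcoeff[OF g u] by auto
  then show ?thesis using ell2_fcoeff[OF L2_Linf_mult[OF hardy_L2[OF u] g], of int] by (simp add: inj_def)
qed

lemma toeplitz_norm_le:
  assumes g: "g \<in> borel_measurable IM" "AE x in IM. cmod (g x) \<le> B" and "0 \<le> B" and c: "ell2 c"
  shows "ell2_norm (toeplitz g c) \<le> B * ell2_norm c"
proof -
  have lg: "Linf g" using g by (auto simp: Linf_def)
  obtain u where u: "hardy c u" using hardy_exists[OF c] .
  have "toeplitz g c = (\<lambda>j. fcoeff (\<lambda>x. g x * u x) (int j))"
    using toeplitz_eq_fcoeff[OF lg u] by auto
  then have "(ell2_norm (toeplitz g c))\<^sup>2 \<le> l2_normsq (\<lambda>x. g x * u x)"
    using ell2_norm_fcoeff_le[OF L2_Linf_mult[OF hardy_L2[OF u] lg], of int] by (simp add: inj_def)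
  also have "\<dots> \<le> (B * ell2_norm c)\<^sup>2"
    using l2_normsq_mult_le[OF hardy_L2[OF u] g] by (simp add: hardy_normsq[OF u] power_mult_distrib)
  finally show ?thesis by (rule power2_le_imp_le) (simp add: ell2_norm_nonneg \<open>0 \<le> B\<close>)
qed

lemma Linf_bound:
  assumes "Linf g"
  obtains B where "0 < B" "AE x in IM. cmod (g x) \<le> B"
proof -
  obtain B where "AE x in IM. cmod (g x) \<le> B" using assms by (auto simp: Linf_def)
  then have "AE x in IM. cmod (g x) \<le> max 1 B" by eventually_elim simp
  then show thesis by (rule that[rotated]) simp
qed

lemma op_bounded_toeplitz:
  assumes g: "Linf g"
  shows "op_bounded (toeplitz g)"
proof -
  obtain B where "0 < B" "AE x in IM. cmod (g x) \<le> B" using Linf_bound[OF g] .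
  then show ?thesis unfolding op_bounded_def
    using g toeplitz_norm_le[of g B] by (intro exI[of _ B]) (auto simp: ell2_toeplitz Linf_def)
qed

lemma toeplitz_diff:
  assumes g: "Linf g" and "ell2 c" "ell2 d"
  shows "toeplitz g (\<lambda>k. c k - d k) = (\<lambda>k. toeplitz g c k - toeplitz g d k)"
proof
  fix j
  obtain u v where u: "hardy c u" and v: "hardy d v" using assms hardy_exists by metis
  show "toeplitz g (\<lambda>k. c k - d k) j = toeplitz g c j - toeplitz g d j"
    using toeplitz_eq_fcoeff[OF g hardy_diff[OF u v]]
    by (simp add: toeplitz_eq_fcoeff[OF g u] toeplitz_eq_fcoeff[OF g v] right_diff_distrib
        fcoeff_diff L2_Linf_mult g hardy_L2[OF u] hardy_L2[OF v])
qed

text \<open>Both sums compute the inner product of \<open>g * u\<close> with \<open>v\<close>, where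
  moving \<open>g\<close> across conjugates it. Thus the symbol \<open>cnj g\<close> gives the
  adjoint operator.\<close>

lemma toeplitz_adjoint:
  assumes g: "Linf g" and "ell2 c" "ell2 d"
  obtains z where "((\<lambda>j. toeplitz g c j * cnj (d j)) has_sum z) UNIV"
    "((\<lambda>k. c k * cnj (toeplitz (\<lambda>x. cnj (g x)) d k)) has_sum z) UNIV"
proof -
  obtain u v where u: "hardy c u" and v: "hardy d v" using assms hardy_exists by metis
  let ?z = "l2_inner (\<lambda>x. g x * u x) v"
  have "((\<lambda>n. fcoeff (\<lambda>x. g x * u x) (int n) * cnj (fcoeff v (int n))) has_sum ?z) UNIV"
    using l2_inner_has_sum[OF L2_Linf_mult[OF hardy_L2[OF u] g] hardy_L2[OF v]] v
    by (subst has_sum_int_nat[of "\<lambda>n. fcoeff (\<lambda>x. g x * u x) n * cnj (fcoeff v n)"]) (auto simp: hardy_def)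
  then have *: "((\<lambda>j. toeplitz g c j * cnj (d j)) has_sum ?z) UNIV"
    using v by (simp add: toeplitz_eq_fcoeff[OF g u] hardy_def)
  have "?z = l2_inner u (\<lambda>x. cnj (g x) * v x)"
    by (simp add: l2_inner_def algebra_simps)
  then have "((\<lambda>n. fcoeff u (int n) * cnj (fcoeff (\<lambda>x. cnj (g x) * v x) (int n))) has_sum ?z) UNIV"
    using l2_inner_has_sum[OF hardy_L2[OF u] L2_Linf_mult[OF hardy_L2[OF v] Linf_cnj[OF g]]] u
    by (subst has_sum_int_nat[of "\<lambda>n. fcoeff u n * cnj (fcoeff (\<lambda>x. cnj (g x) * v x) n)"]) (auto simp: hardy_def)
  then have "((\<lambda>k. c k * cnj (toeplitz (\<lambda>x. cnj (g x)) d k)) has_sum ?z) UNIV"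
    using u by (simp add: toeplitz_eq_fcoeff[OF Linf_cnj[OF g] v] hardy_def)
  with * show thesis by (rule that)
qed

text \<open>With \<open>T = toeplitz g\<close> and lower bound \<open>C\<close>, the map \<open>I - t T* T\<close> is a strict contraction for
  small \<open>t > 0\<close>: the squared norm of its value at \<open>c\<close> is at most
  \<open>(1 - 2 t C\<^sup>2 + t\<^sup>2 B\<^sup>4) \<parallel>c\<parallel>\<^sup>2\<close>.\<close>

lemma toeplitz_normal_surj:
  assumes g: "Linf g" and bb: "op_bounded_below (toeplitz g)" and y: "ell2 y"
  obtains c where "ell2 c" "toeplitz (\<lambda>x. cnj (g x)) (toeplitz g c) = y"
proof -
  interpret Metric_space "Collect ell2" "\<lambda>c d. ell2_norm (\<lambda>k. c k - d k)" by (rule ell2_Metric_space)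
  define R where "R c = toeplitz (\<lambda>x. cnj (g x)) (toeplitz g c)" for c
  have gc: "Linf (\<lambda>x. cnj (g x))" by (rule Linf_cnj[OF g])
  have R_ell2: "ell2 (R c)" if "ell2 c" for c unfolding R_def using that by (intro ell2_toeplitz g gc)
  have R_diff: "R (\<lambda>k. c k - d k) = (\<lambda>k. R c k - R d k)" if "ell2 c" "ell2 d" for c d
    unfolding R_def using that by (simp add: toeplitz_diff g gc ell2_toeplitz)
  obtain C where C: "C > 0" "\<And>c. ell2 c \<Longrightarrow> C * ell2_norm c \<le> ell2_norm (toeplitz g c)"
    using bb unfolding op_bounded_below_def by blast
  obtain B0 where B0: "0 < B0" "AE x in IM. cmod (g x) \<le> B0" using Linf_bound[OF g] .
  \<comment> \<open>Raising the bound to at least \<open>C\<close> makes \<open>q\<close> below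
    nonnegative, so that \<open>sqrt q\<close> can be the contraction factor.\<close>
  define B where "B = max B0 C"
  have B: "0 < B" "C \<le> B" "AE x in IM. cmod (g x) \<le> B" "AE x in IM. cmod (cnj (g x)) \<le> B"
    using B0 by (auto simp: B_def)
  have R_le: "ell2_norm (R c) \<le> B\<^sup>2 * ell2_norm c" if "ell2 c" for c
  proof -
    have "ell2_norm (R c) \<le> B * ell2_norm (toeplitz g c)"
      unfolding R_def using B gc that by (intro toeplitz_norm_le ell2_toeplitz g) (auto simp: Linf_def)
    also have "\<dots> \<le> B * (B * ell2_norm c)"
      using B g that by (intro mult_left_mono toeplitz_norm_le) (auto simp: Linf_def)
    finally show ?thesis by (simp add: power2_eq_square mult.assoc)
  qed
  \<comment> \<open>This \<open>t\<close> minimises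
    \<open>1 - 2 * t * C\<^sup>2 + t\<^sup>2 * B ^ 4\<close>, and the minimum is
    \<open>q\<close>.\<close>
  define t where "t = C\<^sup>2 / B ^ 4"
  define q where "q = 1 - C ^ 4 / B ^ 4"
  have q: "0 \<le> q" "q < 1"
    using B C(1) power_mono[of C B 4] by (auto simp: q_def)
  have t: "0 \<le> t" by (simp add: t_def)
  have contr: "(ell2_norm (\<lambda>k. c k - complex_of_real t * R c k))\<^sup>2 \<le> q * (ell2_norm c)\<^sup>2" if c: "ell2 c" for c
  proof -
    obtain z where z: "((\<lambda>j. toeplitz g c j * cnj (toeplitz g c j)) has_sum z) UNIV"
      "((\<lambda>k. c k * cnj (R c k)) has_sum z) UNIV"
      unfolding R_def using toeplitz_adjoint[OF g c ell2_toeplitz[OF g c]] .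
    have "((\<lambda>j. Re (toeplitz g c j * cnj (toeplitz g c j))) has_sum Re z) UNIV"
      by (rule has_sum_Re[OF z(1)])
    then have "((\<lambda>j. (cmod (toeplitz g c j))\<^sup>2) has_sum Re z) UNIV"
      by (simp only: complex_norm_square[symmetric] Re_complex_of_real)
    then have "Re z = (ell2_norm (toeplitz g c))\<^sup>2"
      using ell2_has_sum[OF ell2_toeplitz[OF g c]] has_sum_unique by blast
    then have Rez: "C\<^sup>2 * (ell2_norm c)\<^sup>2 \<le> Re z"
      using power_mono[OF C(2)[OF c], of 2] C(1) ell2_norm_nonneg[of c] by (simp add: power_mult_distrib)
    have "(ell2_norm (R c))\<^sup>2 \<le> B ^ 4 * (ell2_norm c)\<^sup>2"
      using power_mono[OF R_le[OF c] ell2_norm_nonneg, of 2] by (simp add: power_mult_distrib)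
    then have "t\<^sup>2 * (ell2_norm (R c))\<^sup>2 \<le> t\<^sup>2 * (B ^ 4 * (ell2_norm c)\<^sup>2)"
      by (rule mult_left_mono) simp
    moreover have "2 * t * (C\<^sup>2 * (ell2_norm c)\<^sup>2) \<le> 2 * t * Re z"
      using Rez t by (intro mult_left_mono) auto
    ultimately have "(ell2_norm (\<lambda>k. c k - complex_of_real t * R c k))\<^sup>2 \<le>
        (ell2_norm c)\<^sup>2 - 2 * t * (C\<^sup>2 * (ell2_norm c)\<^sup>2) + t\<^sup>2 * (B ^ 4 * (ell2_norm c)\<^sup>2)"
      using ell2_norm_diff_square[OF c R_ell2[OF c] z(2), of t] by linarith
    also have "\<dots> = q * (ell2_norm c)\<^sup>2"
      using B(1) by (simp add: t_def q_def field_simps power2_eq_square power4_eq_xxxx)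
    finally show ?thesis .
  qed
  \<comment> \<open>Since \<open>t > 0\<close>, the fixed points are the solutions of
    \<open>R c = y\<close>. The constant \<open>y\<close> cancels in differences, so the contraction
    estimate for the linear part applies.\<close>
  define \<Phi> where "\<Phi> c = (\<lambda>k. c k - complex_of_real t * (R c k - y k))" for c
  obtain c where c: "c \<in> Collect ell2" "\<Phi> c = c"
  proof (rule Banach_fixedpoint_thm[of \<Phi> "sqrt q"])
    show mcomplete by (rule ell2_mcomplete)
    show "Collect ell2 \<noteq> {}" using ell2_zero by blast
    show "\<Phi> \<in> Collect ell2 \<rightarrow> Collect ell2"
    proof
      fix c assume "c \<in> Collect ell2"
      then show "\<Phi> c \<in> Collect ell2"
        using ell2_diff[OF _ ell2_cmult[OF ell2_diff[OF R_ell2 y]], of c c t] by (simp add: \<Phi>_def)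
    qed
    show "sqrt q < 1" using q by simp
    fix c d assume "c \<in> Collect ell2" "d \<in> Collect ell2"
    then have cd: "ell2 c" "ell2 d" by auto
    have "(\<lambda>k. \<Phi> c k - \<Phi> d k) =
        (\<lambda>k. (c k - d k) - complex_of_real t * R (\<lambda>k. c k - d k) k)"
      by (simp add: \<Phi>_def R_diff[OF cd] algebra_simps)
    then have "(ell2_norm (\<lambda>k. \<Phi> c k - \<Phi> d k))\<^sup>2 \<le> (sqrt q * ell2_norm (\<lambda>k. c k - d k))\<^sup>2"
      using contr[OF ell2_diff[OF cd]] q by (simp add: power_mult_distrib)
    then show "ell2_norm (\<lambda>k. \<Phi> c k - \<Phi> d k) \<le> sqrt q * ell2_norm (\<lambda>k. c k - d k)"
      by (rule power2_le_imp_le) (simp add: q ell2_norm_nonneg)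
  qed
  have "t > 0" using B(1) C(1) by (simp add: t_def)
  have "R c k = y k" for k
    using fun_cong[OF c(2), of k] \<open>t > 0\<close> by (simp add: \<Phi>_def)
  then have "R c = y" by auto
  then show thesis using that[of c] c(1) by (simp add: R_def)
qed

section \<open>The family generated by a symbol\<close>

definition pos_coeffs :: "(real \<Rightarrow> complex) \<Rightarrow> nat \<Rightarrow> complex" where
  "pos_coeffs f k = fcoeff f (int k)"

text \<open>The conjugation makes \<open>toeplitz g\<close> itself, rather than its entrywise conjugate, appear in
  \<open>toeplitz_neg_coeffs\<close>.\<close>

definition neg_coeffs :: "(real \<Rightarrow> complex) \<Rightarrow> nat \<Rightarrow> complex" where
  "neg_coeffs f k = cnj (fcoeff f (- 1 - int k))"

text \<open>The orthogonal complement of the functions without negative frequencies, hence the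
  functions that the first half of the family does not see.\<close>

definition antianalytic :: "(real \<Rightarrow> complex) \<Rightarrow> bool" where
  "antianalytic f \<longleftrightarrow> L2 f \<and> (\<forall>n\<ge>0. fcoeff f n = 0)"

lemma int_cases_neg:
  fixes n :: int
  obtains k where "n = int k" | k where "n = - 1 - int k"
proof (cases "n \<ge> 0")
  case True
  then show thesis using that(1) zero_le_imp_eq_int by blast
next
  case False
  then have "n = - 1 - int (nat (- 1 - n))" by simp
  then show thesis by (rule that(2))
qed

lemma uminus_int_diff_1: "- int k - 1 = - 1 - int k"
  by simp

lemma has_sum_int_split:
  fixes \<phi> :: "int \<Rightarrow> real"
  assumes "((\<lambda>k. \<phi> (int k)) has_sum a) UNIV" "((\<lambda>k. \<phi> (- 1 - int k)) has_sum b) UNIV"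
  shows "(\<phi> has_sum (a + b)) UNIV"
proof -
  let ?h = "\<lambda>k. - 1 - int k"
  have "(\<phi> has_sum a) (range int)" "(\<phi> has_sum b) (range ?h)"
    using assms has_sum_reindex[of int UNIV \<phi>] has_sum_reindex[of ?h UNIV \<phi>]
    by (simp_all add: o_def inj_on_def)
  then have "(\<phi> has_sum (a + b)) (range int \<union> range ?h)"
    by (rule has_sum_Un_disjoint) auto
  moreover have "range int \<union> range ?h = UNIV"
    by (auto intro: int_cases_neg)
  ultimately show ?thesis by simp
qed

lemma ell2_pos_coeffs: "L2 f \<Longrightarrow> ell2 (pos_coeffs f)"
  using ell2_fcoeff[of f int] by (simp add: pos_coeffs_def[abs_def] inj_def)

lemma ell2_neg_coeffs: "L2 f \<Longrightarrow> ell2 (neg_coeffs f)"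
  using ell2_fcoeff[of f "\<lambda>k. - 1 - int k"] by (simp add: neg_coeffs_def[abs_def] inj_def)

lemma ell2_norm_neg_coeffs_le: "L2 f \<Longrightarrow> (ell2_norm (neg_coeffs f))\<^sup>2 \<le> l2_normsq f"
  using ell2_norm_fcoeff_le[of f "\<lambda>k. - 1 - int k"]
  by (simp add: neg_coeffs_def[abs_def] inj_def ell2_norm_def)

lemma L2_normsq_split:
  assumes "L2 f"
  shows "l2_normsq f = (ell2_norm (pos_coeffs f))\<^sup>2 + (ell2_norm (neg_coeffs f))\<^sup>2"
proof -
  have "((\<lambda>n. (cmod (fcoeff f n))\<^sup>2) has_sum (ell2_norm (pos_coeffs f))\<^sup>2 + (ell2_norm (neg_coeffs f))\<^sup>2) UNIV"
    using ell2_has_sum[OF ell2_pos_coeffs[OF assms]] ell2_has_sum[OF ell2_neg_coeffs[OF assms]]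
    by (intro has_sum_int_split) (simp_all add: pos_coeffs_def neg_coeffs_def)
  then show ?thesis using Parseval[OF assms] has_sum_unique by blast
qed

lemma antianalytic_L2: "antianalytic f \<Longrightarrow> L2 f"
  by (simp add: antianalytic_def)

lemma antianalytic_pos_coeffs: "antianalytic f \<Longrightarrow> pos_coeffs f = (\<lambda>_. 0)"
  by (auto simp: antianalytic_def pos_coeffs_def)

text \<open>Conjugation sends frequency \<open>n\<close> to \<open>- n\<close>, and the factor
  \<open>chr (- 1)\<close> moves it on to \<open>- 1 - n\<close>, an involution exchanging negative
  and nonnegative frequencies. Without the shift, frequency 0 would stay fixed.\<close>

lemma antianalytic_hardy:
  assumes "antianalytic f"
  shows "hardy (neg_coeffs f) (\<lambda>x. chr (- 1) x * cnj (f x))"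
  using assms L2_Linf_mult[OF L2_cnj[of f] Linf_chr[of "-1"]]
  by (auto simp: antianalytic_def hardy_def fcoeff_chr_mult fcoeff_cnj neg_coeffs_def uminus_int_diff_1)

lemma antianalytic_exists:
  assumes "ell2 c"
  obtains f where "antianalytic f" "neg_coeffs f = c"
proof -
  obtain u where u: "hardy c u" using hardy_exists[OF assms] .
  define f where "f x = cnj (chr 1 x * u x)" for x
  have "L2 f" unfolding f_def by (intro L2_cnj L2_Linf_mult hardy_L2[OF u] Linf_chr)
  moreover have co: "fcoeff f n = cnj (fcoeff u (- n - 1))" for n
    unfolding f_def fcoeff_cnj fcoeff_chr_mult ..
  ultimately have "antianalytic f"
    using u by (simp add: antianalytic_def hardy_def)
  moreover have "neg_coeffs f = c"
    using u by (auto simp: neg_coeffs_def co hardy_def)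
  ultimately show thesis by (rule that)
qed

text \<open>The flip conjugates the multiplier: multiplication by \<open>cnj g\<close> becomes
  multiplication by \<open>g\<close>. The factor \<open>cnj g\<close> is the one produced by moving
  \<open>g\<close> out of the second argument of \<open>l2_inner f (Fam g n)\<close>.\<close>

lemma toeplitz_neg_coeffs:
  assumes g: "Linf g" and f: "antianalytic f"
  shows "toeplitz g (neg_coeffs f) = neg_coeffs (\<lambda>x. cnj (g x) * f x)"
proof
  fix j
  have "toeplitz g (neg_coeffs f) j = fcoeff (\<lambda>x. g x * (chr (- 1) x * cnj (f x))) (int j)"
    by (rule toeplitz_eq_fcoeff[OF g antianalytic_hardy[OF f]])
  also have "(\<lambda>x. g x * (chr (- 1) x * cnj (f x))) = (\<lambda>x. chr (- 1) x * cnj (cnj (g x) * f x))"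
    by (simp add: algebra_simps)
  also have "fcoeff \<dots> (int j) = neg_coeffs (\<lambda>x. cnj (g x) * f x) j"
    unfolding fcoeff_chr_mult fcoeff_cnj neg_coeffs_def by (simp add: uminus_int_diff_1)
  finally show "toeplitz g (neg_coeffs f) j = neg_coeffs (\<lambda>x. cnj (g x) * f x) j" .
qed

lemma toeplitz_cnj_neg_coeffs:
  assumes g: "Linf g" and f: "antianalytic f"
  shows "toeplitz (\<lambda>x. cnj (g x)) (neg_coeffs f) = neg_coeffs (\<lambda>x. g x * f x)"
  using toeplitz_neg_coeffs[OF Linf_cnj[OF g] f] by simp

section \<open>Inner products with the family, and completeness\<close>

lemma L2_Fam: "Linf g \<Longrightarrow> L2 (Fam g n)"
  by (simp add: Fam_def L2_Linf_mult)

lemma l2_inner_Fam_pos: "l2_inner f (Fam g (int k)) = pos_coeffs f k"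
  by (simp add: Fam_def pos_coeffs_def fcoeff_inner)

lemma l2_inner_Fam_neg: "l2_inner f (Fam g (- 1 - int k)) = cnj (neg_coeffs (\<lambda>x. cnj (g x) * f x) k)"
  by (simp add: Fam_def neg_coeffs_def fcoeff_def l2_inner_def algebra_simps)

lemma Fam_complete_iff:
  assumes g: "Linf g"
  shows "L2_complete (Fam g) \<longleftrightarrow> op_injective (toeplitz g)"
proof
  assume complete: "L2_complete (Fam g)"
  show "op_injective (toeplitz g)"
    unfolding op_injective_def
  proof (intro allI impI)
    fix c assume "ell2 c" and 0: "toeplitz g c = (\<lambda>_. 0)"
    then obtain f where f: "antianalytic f" "neg_coeffs f = c" using antianalytic_exists by blast
    have "l2_inner f (Fam g n) = 0" for n
      by (cases n rule: int_cases_neg)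
        (use toeplitz_neg_coeffs[OF g f(1)] f 0 antianalytic_pos_coeffs[OF f(1)] in
          \<open>simp_all add: l2_inner_Fam_pos l2_inner_Fam_neg fun_eq_iff\<close>)
    then have "AE x in IM. f x = 0"
      using complete antianalytic_L2[OF f(1)] unfolding L2_complete_def by blast
    then have "fcoeff f n = fcoeff (\<lambda>_. 0) n" for n
      by (rule fcoeff_cong[OF _ antianalytic_L2[OF f(1)] L2_const])
    also have "fcoeff (\<lambda>_. 0) n = 0" for n by (simp add: fcoeff_def)
    finally show "c = (\<lambda>_. 0)"
      unfolding f(2)[symmetric] by (auto simp: neg_coeffs_def)
  qed
next
  assume inj: "op_injective (toeplitz g)"
  show "L2_complete (Fam g)"
    unfolding L2_complete_def
  proof (intro allI impI)
    fix f assume f: "L2 f" and 0: "\<forall>n. l2_inner f (Fam g n) = 0"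
    have pos: "fcoeff f (int k) = 0" for k
      using 0[rule_format, of "int k"] by (simp add: l2_inner_Fam_pos pos_coeffs_def)
    then have anti: "antianalytic f"
      using f zero_le_imp_eq_int by (auto simp: antianalytic_def)
    have "neg_coeffs (\<lambda>x. cnj (g x) * f x) k = 0" for k
      using 0[rule_format, of "- 1 - int k"] by (simp add: l2_inner_Fam_neg)
    then have "toeplitz g (neg_coeffs f) = (\<lambda>_. 0)"
      by (auto simp: toeplitz_neg_coeffs[OF g anti])
    then have "neg_coeffs f = (\<lambda>_. 0)"
      using inj ell2_neg_coeffs[OF f] by (simp add: op_injective_def)
    then have "fcoeff f n = 0" for n
      by (cases n rule: int_cases_neg) (auto simp: pos neg_coeffs_def fun_eq_iff)
    then show "AE x in IM. f x = 0" by (rule fcoeff_zero_imp_AE_zero[OF f])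
  qed
qed

section \<open>Frame bounds\<close>

lemma Fam_square_sum:
  assumes g: "Linf g" and f: "L2 f"
  shows "((\<lambda>n. (cmod (l2_inner f (Fam g n)))\<^sup>2) has_sum
    (ell2_norm (pos_coeffs f))\<^sup>2 + (ell2_norm (neg_coeffs (\<lambda>x. cnj (g x) * f x)))\<^sup>2) UNIV"
  using ell2_has_sum[OF ell2_pos_coeffs[OF f]]
    ell2_has_sum[OF ell2_neg_coeffs[OF L2_Linf_mult[OF f Linf_cnj[OF g]]]]
  by (intro has_sum_int_split) (simp_all add: l2_inner_Fam_pos l2_inner_Fam_neg)

text \<open>On functions with negative frequencies only, the frame sum is the squared norm of
  \<open>toeplitz g c\<close>, so the root of the lower frame bound is a lower bound for the
  operator.\<close>

lemma Fam_frame_imp_bounded_below: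
  assumes g: "Linf g" and frame: "L2_frame (Fam g)"
  shows "op_bounded_below (toeplitz g)"
proof -
  obtain A where A: "0 < A"
    and le: "\<And>f. L2 f \<Longrightarrow> A * l2_normsq f \<le> (\<Sum>\<^sub>\<infinity>k. (cmod (l2_inner f (Fam g k)))\<^sup>2)"
    using frame unfolding L2_frame_def by blast
  have "sqrt A * ell2_norm c \<le> ell2_norm (toeplitz g c)" if c: "ell2 c" for c
  proof -
    obtain f where f: "antianalytic f" "neg_coeffs f = c" using antianalytic_exists[OF c] .
    have "(\<Sum>\<^sub>\<infinity>k. (cmod (l2_inner f (Fam g k)))\<^sup>2) = (ell2_norm (toeplitz g c))\<^sup>2"
      using infsumI[OF Fam_square_sum[OF g antianalytic_L2[OF f(1)]]] toeplitz_neg_coeffs[OF g f(1)]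
      by (simp add: f antianalytic_pos_coeffs)
    moreover have "l2_normsq f = (ell2_norm c)\<^sup>2"
      using L2_normsq_split[OF antianalytic_L2[OF f(1)]] by (simp add: f antianalytic_pos_coeffs)
    ultimately have "(sqrt A * ell2_norm c)\<^sup>2 \<le> (ell2_norm (toeplitz g c))\<^sup>2"
      using le[OF antianalytic_L2[OF f(1)]] A by (simp add: power_mult_distrib)
    then show ?thesis using ell2_norm_nonneg by (rule power2_le_imp_le)
  qed
  then show ?thesis using A unfolding op_bounded_below_def by (intro exI[of _ "sqrt A"]) auto
qed

text \<open>The lower bound of \<open>toeplitz g\<close> speaks only of the antianalytic part
  \<open>m\<close> of \<open>f\<close>. Passing from \<open>m\<close> to \<open>f\<close> costs a
  term from the Hardy part \<open>p\<close>, and that term is controlled by \<open>B\<close> and the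
  nonnegative coefficients.\<close>

lemma bounded_below_imp_Fam_frame:
  assumes g: "Linf g" and bb: "op_bounded_below (toeplitz g)"
  shows "L2_frame (Fam g)"
proof -
  obtain C where C: "C > 0" "\<And>c. ell2 c \<Longrightarrow> C * ell2_norm c \<le> ell2_norm (toeplitz g c)"
    using bb unfolding op_bounded_below_def by blast
  obtain B where B: "0 < B" "AE x in IM. cmod (cnj (g x)) \<le> B" using Linf_bound[OF Linf_cnj[OF g]] .
  have gc: "Linf (\<lambda>x. cnj (g x))" "(\<lambda>x. cnj (g x)) \<in> borel_measurable IM"
    using Linf_cnj[OF g] by (auto simp: Linf_def)
  have neg_le: "(ell2_norm (neg_coeffs (\<lambda>x. cnj (g x) * f x)))\<^sup>2 \<le> B\<^sup>2 * l2_normsq f" if "L2 f" for f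
    using ell2_norm_neg_coeffs_le[OF L2_Linf_mult[OF that gc(1)]] l2_normsq_mult_le[OF that gc(2) B(2)] by linarith
  \<comment> \<open>With \<open>X\<close>, \<open>Y\<close>, \<open>Z\<close> as below, the estimate
    obtained is \<open>C\<^sup>2 * Z \<le> 2 * Y + 2 * (B\<^sup>2 * X)\<close>. Adding
    \<open>C\<^sup>2 * X\<close> and enlarging the coefficients of \<open>X\<close> and
    \<open>Y\<close> to a common one gives the denominator.\<close>
  define A where "A = C\<^sup>2 / (C\<^sup>2 + 2 * B\<^sup>2 + 2)"
  have "C\<^sup>2 + 2 * B\<^sup>2 + 2 > 0" by (intro add_nonneg_pos) auto
  show ?thesis
    unfolding L2_frame_def
  proof (rule exI[of _ A], rule exI[of _ "1 + B\<^sup>2"], intro conjI allI impI)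
    show "0 < A" using C(1) \<open>C\<^sup>2 + 2 * B\<^sup>2 + 2 > 0\<close> by (simp add: A_def)
    have "A \<le> 1" using \<open>C\<^sup>2 + 2 * B\<^sup>2 + 2 > 0\<close> by (simp add: A_def)
    then show "A \<le> 1 + B\<^sup>2" by (simp add: add_increasing2)
    fix f assume f: "L2 f"
    define X where "X = (ell2_norm (pos_coeffs f))\<^sup>2"
    define Y where "Y = (ell2_norm (neg_coeffs (\<lambda>x. cnj (g x) * f x)))\<^sup>2"
    define Z where "Z = (ell2_norm (neg_coeffs f))\<^sup>2"
    have nf: "l2_normsq f = X + Z" unfolding X_def Z_def by (rule L2_normsq_split[OF f])
    note sm = Fam_square_sum[OF g f, folded X_def Y_def]
    show "(\<lambda>k. (cmod (l2_inner f (Fam g k)))\<^sup>2) summable_on UNIV" by (rule has_sum_imp_summable[OF sm])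
    have XYZ: "0 \<le> X" "0 \<le> Y" "0 \<le> Z" by (simp_all add: X_def Y_def Z_def)
    show "(\<Sum>\<^sub>\<infinity>k. (cmod (l2_inner f (Fam g k)))\<^sup>2) \<le> (1 + B\<^sup>2) * l2_normsq f"
      unfolding infsumI[OF sm] using neg_le[OF f, folded Y_def, unfolded nf] XYZ by (simp add: nf algebra_simps)
    obtain p where p: "hardy (pos_coeffs f) p" using hardy_exists[OF ell2_pos_coeffs[OF f]] .
    define m where "m x = f x - p x" for x
    have m: "L2 m" unfolding m_def by (rule L2_diff[OF f hardy_L2[OF p]])
    have m_co: "fcoeff m n = fcoeff f n - fcoeff p n" for n
      unfolding m_def by (rule fcoeff_diff[OF f hardy_L2[OF p]])
    have "fcoeff m n = 0" if "n \<ge> 0" for n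
      using p zero_le_imp_eq_int[OF that] by (auto simp: m_co hardy_def pos_coeffs_def)
    then have anti: "antianalytic m" using m by (simp add: antianalytic_def)
    have neg_m: "neg_coeffs m = neg_coeffs f"
      using p by (auto simp: neg_coeffs_def m_co hardy_def)
    let ?F = "neg_coeffs (\<lambda>x. cnj (g x) * f x)" and ?P = "neg_coeffs (\<lambda>x. cnj (g x) * p x)"
    have "toeplitz g (neg_coeffs f) = (\<lambda>k. ?F k - ?P k)"
      using toeplitz_neg_coeffs[OF g anti]
        fcoeff_diff[OF L2_Linf_mult[OF f gc(1)] L2_Linf_mult[OF hardy_L2[OF p] gc(1)]]
      by (simp add: neg_m neg_coeffs_def fun_eq_iff m_def right_diff_distrib)
    then have "ell2_norm (toeplitz g (neg_coeffs f)) \<le> ell2_norm ?F + ell2_norm ?P"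
      using ell2_norm_triangle_diff[of ?F ?P] f gc hardy_L2[OF p]
      by (simp add: ell2_neg_coeffs L2_Linf_mult)
    then have "C * ell2_norm (neg_coeffs f) \<le> ell2_norm ?F + ell2_norm ?P"
      using C(2)[OF ell2_neg_coeffs[OF f]] by linarith
    then have "(C * ell2_norm (neg_coeffs f))\<^sup>2 \<le> (ell2_norm ?F + ell2_norm ?P)\<^sup>2"
      using C(1) ell2_norm_nonneg by (intro power_mono) auto
    also have "\<dots> \<le> 2 * (ell2_norm ?F)\<^sup>2 + 2 * (ell2_norm ?P)\<^sup>2"
      using sum_squares_bound[of "ell2_norm ?F" "ell2_norm ?P"] by (simp add: power2_sum)
    also have "(ell2_norm ?P)\<^sup>2 \<le> B\<^sup>2 * X"
      using neg_le[OF hardy_L2[OF p]] by (simp add: hardy_normsq[OF p] X_def)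
    finally have "C\<^sup>2 * Z \<le> 2 * Y + 2 * (B\<^sup>2 * X)"
      by (simp add: Z_def Y_def power_mult_distrib)
    moreover have "0 \<le> C\<^sup>2 * Y" "0 \<le> B\<^sup>2 * Y" using XYZ by simp_all
    moreover have "(C\<^sup>2 + 2 * B\<^sup>2 + 2) * (X + Y) =
        C\<^sup>2 * X + C\<^sup>2 * Y + 2 * (B\<^sup>2 * X) + 2 * (B\<^sup>2 * Y) + 2 * X + 2 * Y"
      by (simp add: algebra_simps)
    ultimately have "C\<^sup>2 * (X + Z) \<le> (C\<^sup>2 + 2 * B\<^sup>2 + 2) * (X + Y)"
      unfolding distrib_left using XYZ by linarith
    then show "A * l2_normsq f \<le> (\<Sum>\<^sub>\<infinity>k. (cmod (l2_inner f (Fam g k)))\<^sup>2)"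
      unfolding infsumI[OF sm] nf A_def using \<open>C\<^sup>2 + 2 * B\<^sup>2 + 2 > 0\<close>
      by (simp add: pos_divide_le_eq mult.commute)
  qed
qed

section \<open>Expansions and the Riesz basis property\<close>

lemma Fam_expansion:
  assumes g: "Linf g" and f: "L2 f" and w: "antianalytic w"
    and neg: "neg_coeffs f = neg_coeffs (\<lambda>x. g x * w x)"
  shows "L2_expansion (Fam g) (\<lambda>n. if n < 0 then fcoeff w n else fcoeff (\<lambda>x. f x - g x * w x) n) f"
proof -
  define r where "r x = f x - g x * w x" for x
  have w2: "L2 w" by (rule antianalytic_L2[OF w])
  have r: "L2 r" unfolding r_def by (intro L2_diff f L2_Linf_mult w2 g)
  have r_neg: "fcoeff r n = 0" if "n < 0" for n
  proof -
    have "fcoeff r n = fcoeff f n - fcoeff (\<lambda>x. g x * w x) n"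
      unfolding r_def by (intro fcoeff_diff f L2_Linf_mult w2 g)
    with that fun_cong[OF neg, of "nat (- 1 - n)"] show ?thesis by (simp add: neg_coeffs_def)
  qed
  have w_pos: "fcoeff w n = 0" if "n \<ge> 0" for n using w that by (simp add: antianalytic_def)
  define \<alpha> where "\<alpha> n = (if n < 0 then fcoeff w n else fcoeff r n)" for n
  obtain B where B: "0 < B" "AE x in IM. cmod (g x) \<le> B" using Linf_bound[OF g] .
  let ?E = "\<lambda>h F x. h x - trig_sum (fcoeff h) F x"
  \<comment> \<open>At each index only one of the two series has a term: \<open>r\<close> has no
    negative and \<open>w\<close> no nonnegative frequencies. Hence the same \<open>F\<close>
    truncates both Fourier series, as a limit over finite index sets requires.\<close>
  have split: "f x - (\<Sum>k\<in>F. \<alpha> k * Fam g k x) = ?E r F x + g x * ?E w F x" for F x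
  proof -
    have "\<alpha> k * Fam g k x = fcoeff r k * chr k x + g x * (fcoeff w k * chr k x)" for k
      by (cases "k < 0") (simp_all add: \<alpha>_def Fam_def r_neg w_pos)
    then show ?thesis by (simp add: r_def sum.distrib sum_distrib_left algebra_simps)
  qed
  have "l2_normsq (\<lambda>x. f x - (\<Sum>k\<in>F. \<alpha> k * Fam g k x)) \<le>
      2 * l2_normsq (?E r F) + 2 * (B\<^sup>2 * l2_normsq (?E w F))" for F
  proof -
    have "l2_normsq (\<lambda>x. ?E r F x + g x * ?E w F x) \<le> 2 * l2_normsq (?E r F) + 2 * l2_normsq (\<lambda>x. g x * ?E w F x)"
      by (intro l2_normsq_add_le L2_Linf_mult L2_diff r w2 g L2_trig_sum)
    moreover have "l2_normsq (\<lambda>x. g x * ?E w F x) \<le> B\<^sup>2 * l2_normsq (?E w F)"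
      using g by (intro l2_normsq_mult_le L2_diff w2 L2_trig_sum B) (simp add: Linf_def)
    ultimately show ?thesis unfolding split by linarith
  qed
  moreover have "((\<lambda>F. 2 * l2_normsq (?E r F) + 2 * (B\<^sup>2 * l2_normsq (?E w F))) \<longlongrightarrow> 2 * 0 + 2 * (B\<^sup>2 * 0))
      (finite_subsets_at_top UNIV)"
    by (intro tendsto_intros Fourier_series_tendsto r w2)
  ultimately have "((\<lambda>F. l2_normsq (\<lambda>x. f x - (\<Sum>k\<in>F. \<alpha> k * Fam g k x))) \<longlongrightarrow> 0) (finite_subsets_at_top UNIV)"
    by - (rule tendsto_sandwich[OF _ _ tendsto_const, of _ _ _ "\<lambda>F. 2 * l2_normsq (?E r F) + 2 * (B\<^sup>2 * l2_normsq (?E w F))"],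
        simp_all add: always_eventually)
  then show ?thesis unfolding L2_expansion_def \<alpha>_def r_def .
qed

lemma expansion_inner_has_sum:
  assumes h: "\<And>n. L2 (h n)" and f: "L2 f" and \<phi>: "L2 \<phi>" and ex: "L2_expansion h \<alpha> f"
  shows "((\<lambda>n. \<alpha> n * l2_inner (h n) \<phi>) has_sum l2_inner f \<phi>) UNIV"
proof -
  have "L2 (\<lambda>x. \<Sum>k\<in>F. \<alpha> k * h k x)" for F by (intro L2_sum L2_cmult h)
  from l2_inner_tendsto[OF this f \<phi> ex[unfolded L2_expansion_def]]
  show ?thesis
    unfolding has_sum_def by (simp add: l2_inner_sum L2_cmult h \<phi> l2_inner_cmult)
qed

lemma Fam_expansion_unique:
  assumes g: "Linf g" and surj: "\<And>d. ell2 d \<Longrightarrow> \<exists>c. ell2 c \<and> toeplitz g c = d"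
    and f: "L2 f" and \<alpha>: "L2_expansion (Fam g) \<alpha> f" and \<beta>: "L2_expansion (Fam g) \<beta> f"
  shows "\<alpha> = \<beta>"
proof -
  have diff: "((\<lambda>n. (\<alpha> n - \<beta> n) * l2_inner (Fam g n) \<phi>) has_sum 0) UNIV" if "L2 \<phi>" for \<phi>
    using has_sum_add[OF expansion_inner_has_sum[OF L2_Fam[OF g] f that \<alpha>]
        has_sum_uminusI[OF expansion_inner_has_sum[OF L2_Fam[OF g] f that \<beta>]]]
    by (simp add: left_diff_distrib)
  \<comment> \<open>A product may vanish through orthogonality or because the coefficients at
    \<open>n\<close> are already known to agree; the latter is what the nonnegative indices
    use.\<close>
  have single: "\<alpha> m = \<beta> m"
    if "L2 \<phi>" "l2_inner (Fam g m) \<phi> = 1" "\<And>n. n \<noteq> m \<Longrightarrow> (\<alpha> n - \<beta> n) * l2_inner (Fam g n) \<phi> = 0" for m \<phi>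
  proof -
    have "((\<lambda>n. (\<alpha> n - \<beta> n) * l2_inner (Fam g n) \<phi>) has_sum (\<alpha> m - \<beta> m)) UNIV"
      using that by (intro has_sum_finite_neutralI[of "{m}"]) auto
    then show ?thesis using has_sum_unique[OF diff[OF that(1)]] by fastforce
  qed
  have neg: "\<alpha> (- 1 - int k) = \<beta> (- 1 - int k)" for k
  proof -
    have "ell2 (\<lambda>j. if j = k then 1 else 0)"
      using ell2_pos_coeffs[OF L2_chr[of "int k"]] by (simp add: pos_coeffs_def[abs_def] fcoeff_chr eq_commute)
    then obtain c where c: "ell2 c" "toeplitz g c = (\<lambda>j. if j = k then 1 else 0)" using surj by blast
    obtain \<phi> where \<phi>: "antianalytic \<phi>" "neg_coeffs \<phi> = c" using antianalytic_exists[OF c(1)] .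
    have inner_neg: "l2_inner (Fam g (- 1 - int j)) \<phi> = (if j = k then 1 else 0)" for j
      using toeplitz_neg_coeffs[OF g \<phi>(1)] c(2) \<phi>(2) l2_inner_commute[of "Fam g (- 1 - int j)" \<phi>]
      by (simp add: l2_inner_Fam_neg fun_eq_iff)
    have inner_pos: "l2_inner (Fam g (int j)) \<phi> = 0" for j
      using antianalytic_pos_coeffs[OF \<phi>(1)] l2_inner_commute[of "Fam g (int j)" \<phi>]
      by (simp add: l2_inner_Fam_pos)
    show ?thesis
    proof (rule single[OF antianalytic_L2[OF \<phi>(1)]])
      fix n :: int assume "n \<noteq> - 1 - int k"
      then show "(\<alpha> n - \<beta> n) * l2_inner (Fam g n) \<phi> = 0"
        by (cases n rule: int_cases_neg) (auto simp: inner_neg inner_pos)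
    qed (simp add: inner_neg)
  qed
  \<comment> \<open>\<open>chr (int k)\<close> need not be orthogonal to the members
    \<open>g * chr n\<close> with \<open>n < 0\<close>; these terms drop out because their
    coefficients agree by \<open>neg\<close>.\<close>
  have "\<alpha> (int k) = \<beta> (int k)" for k
  proof (rule single[OF L2_chr[of "int k"]])
    fix n :: int assume "n \<noteq> int k"
    then show "(\<alpha> n - \<beta> n) * l2_inner (Fam g n) (chr (int k)) = 0"
      by (cases n rule: int_cases_neg) (auto simp: neg Fam_def l2_inner_chr)
  qed (simp add: Fam_def l2_inner_chr)
  with neg show ?thesis by (metis ext int_cases_neg)
qed

lemma Fam_riesz_basis_iff:
  assumes g: "Linf g"
  shows "L2_riesz_basis (Fam g) \<longleftrightarrow> op_invertible (toeplitz g)"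
proof
  assume riesz: "L2_riesz_basis (Fam g)"
  then have bb: "op_bounded_below (toeplitz g)"
    using Fam_frame_imp_bounded_below[OF g] by (simp add: L2_riesz_basis_def)
  \<comment> \<open>For \<open>d\<close> in the kernel, \<open>g * w\<close> has no negative
    frequencies. So the zero function has an expansion whose coefficients at negative indices are
    those of \<open>w\<close>, and uniqueness compares it with the trivial expansion.\<close>
  have adj_inj: "d = (\<lambda>_. 0)" if d: "ell2 d" "toeplitz (\<lambda>x. cnj (g x)) d = (\<lambda>_. 0)" for d
  proof -
    obtain w where w: "antianalytic w" "neg_coeffs w = d" using antianalytic_exists[OF d(1)] .
    have "neg_coeffs (\<lambda>x. 0) = neg_coeffs (\<lambda>x. g x * w x)"
      using toeplitz_cnj_neg_coeffs[OF g w(1)] w(2) d(2) by (simp add: neg_coeffs_def fcoeff_def fun_eq_iff)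
    note ex = Fam_expansion[OF g L2_const w(1) this]
    have "L2_expansion (Fam g) (\<lambda>_. 0) (\<lambda>_. 0)"
      by (simp add: L2_expansion_def l2_normsq_def)
    with ex riesz L2_const[of 0]
    have *: "(\<lambda>n. if n < 0 then fcoeff w n else fcoeff (\<lambda>x. 0 - g x * w x) n) = (\<lambda>_. 0)"
      unfolding L2_riesz_basis_def by blast
    have "neg_coeffs w k = 0" for k
      using fun_cong[OF *, of "- 1 - int k"] by (simp add: neg_coeffs_def)
    with w(2) show ?thesis by auto
  qed
  have surj: "\<exists>c. ell2 c \<and> toeplitz g c = d" if d: "ell2 d" for d
  proof -
    have gc: "Linf (\<lambda>x. cnj (g x))" by (rule Linf_cnj[OF g])
    obtain c where c: "ell2 c" "toeplitz (\<lambda>x. cnj (g x)) (toeplitz g c) = toeplitz (\<lambda>x. cnj (g x)) d"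
      using toeplitz_normal_surj[OF g bb ell2_toeplitz[OF gc d]] .
    have "toeplitz (\<lambda>x. cnj (g x)) (\<lambda>k. toeplitz g c k - d k) = (\<lambda>_. 0)"
      using toeplitz_diff[OF gc ell2_toeplitz[OF g c(1)] d] c(2) by simp
    then have "(\<lambda>k. toeplitz g c k - d k) = (\<lambda>_. 0)"
      by (rule adj_inj[OF ell2_diff[OF ell2_toeplitz[OF g c(1)] d]])
    then show ?thesis using c(1) by (auto simp: fun_eq_iff)
  qed
  obtain C where C: "C > 0" "\<And>c. ell2 c \<Longrightarrow> C * ell2_norm c \<le> ell2_norm (toeplitz g c)"
    using bb unfolding op_bounded_below_def by blast
  have inj: "c = d" if cd: "ell2 c" "ell2 d" "toeplitz g c = toeplitz g d" for c d
  proof -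
    have "toeplitz g (\<lambda>k. c k - d k) = (\<lambda>_. 0)" using toeplitz_diff[OF g cd(1,2)] cd(3) by simp
    then have "C * ell2_norm (\<lambda>k. c k - d k) \<le> 0" using C(2)[OF ell2_diff[OF cd(1,2)]] by simp
    then have "ell2_norm (\<lambda>k. c k - d k) \<le> 0" using C(1) by (simp add: mult_le_0_iff)
    then have "cmod (c k - d k) \<le> 0" for k
      using ell2_component_le[OF ell2_diff[OF cd(1,2)], of k] by linarith
    then show ?thesis by auto
  qed
  \<comment> \<open>Outside the square-summable sequences the choice is arbitrary;
    \<open>op_invertible\<close> inspects \<open>S\<close> on square-summable sequences
    only.\<close>
  define S where "S d = (SOME c. ell2 c \<and> toeplitz g c = d)" for d
  have S: "ell2 (S d)" "toeplitz g (S d) = d" if "ell2 d" for d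
    using someI_ex[OF surj[OF that]] by (auto simp: S_def)
  show "op_invertible (toeplitz g)"
    unfolding op_invertible_def op_bounded_def
  proof (intro exI[of _ S] exI[of _ "1 / C"] conjI allI impI)
    fix c assume c: "ell2 c"
    show "ell2 (S c)" "toeplitz g (S c) = c" by (rule S[OF c])+
    show "ell2_norm (S c) \<le> 1 / C * ell2_norm c"
      using C(2)[OF S(1)[OF c]] C(1) by (simp add: S(2)[OF c] field_simps)
    show "S (toeplitz g c) = c"
      using S[OF ell2_toeplitz[OF g c]] by (rule inj[OF _ c])
  qed
next
  assume "op_invertible (toeplitz g)"
  then obtain S where S: "op_bounded S" "\<And>c. ell2 c \<Longrightarrow> S (toeplitz g c) = c \<and> toeplitz g (S c) = c"
    unfolding op_invertible_def by blast
  then obtain B where B: "\<And>c. ell2 c \<Longrightarrow> ell2 (S c) \<and> ell2_norm (S c) \<le> B * ell2_norm c"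
    unfolding op_bounded_def by blast
  \<comment> \<open>The constant \<open>B\<close> from \<open>op_bounded\<close> may fail to be
    positive, hence \<open>max 1 B\<close>.\<close>
  have bb: "op_bounded_below (toeplitz g)"
    unfolding op_bounded_below_def
  proof (intro exI[of _ "1 / max 1 B"] conjI allI impI)
    fix c assume c: "ell2 c"
    have "ell2_norm c \<le> B * ell2_norm (toeplitz g c)"
      using B[OF ell2_toeplitz[OF g c]] S(2)[OF c] by simp
    also have "\<dots> \<le> max 1 B * ell2_norm (toeplitz g c)"
      by (intro mult_right_mono ell2_norm_nonneg) simp
    finally show "1 / max 1 B * ell2_norm c \<le> ell2_norm (toeplitz g c)"
      by (simp add: pos_divide_le_eq mult.commute)
  qed simp
  have surj: "\<exists>c. ell2 c \<and> toeplitz g c = d" if "ell2 d" for d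
    using B[OF that] S(2)[OF that] by blast
  \<comment> \<open>The solution of the adjoint equation is sought in the range of
    \<open>toeplitz g\<close>, where the normal equation supplies it.\<close>
  have "\<exists>\<alpha>. L2_expansion (Fam g) \<alpha> f" if f: "L2 f" for f
  proof -
    obtain c where c: "ell2 c" "toeplitz (\<lambda>x. cnj (g x)) (toeplitz g c) = neg_coeffs f"
      using toeplitz_normal_surj[OF g bb ell2_neg_coeffs[OF f]] .
    obtain w where w: "antianalytic w" "neg_coeffs w = toeplitz g c"
      using antianalytic_exists[OF ell2_toeplitz[OF g c(1)]] .
    have "neg_coeffs f = neg_coeffs (\<lambda>x. g x * w x)"
      using toeplitz_cnj_neg_coeffs[OF g w(1)] c(2) w(2) by simp
    from Fam_expansion[OF g f w(1) this] show ?thesis by blast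
  qed
  then show "L2_riesz_basis (Fam g)"
    using bounded_below_imp_Fam_frame[OF g bb] Fam_expansion_unique[OF g surj]
    unfolding L2_riesz_basis_def by blast
qed

theorem theorem1p1:
  fixes g :: "real \<Rightarrow> complex"
  assumes "Linf g"
  shows "(L2_complete (Fam g) \<longleftrightarrow> op_injective (toeplitz g))
       \<and> (L2_frame (Fam g) \<longleftrightarrow> op_bounded (toeplitz g) \<and> op_bounded_below (toeplitz g))
       \<and> (L2_riesz_basis (Fam g) \<longleftrightarrow> op_bounded (toeplitz g) \<and> op_invertible (toeplitz g))"
  using Fam_complete_iff[OF assms] Fam_frame_imp_bounded_below[OF assms]
    bounded_below_imp_Fam_frame[OF assms] op_bounded_toeplitz[OF assms] Fam_riesz_basis_iff[OF assms]
  by blast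

end
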